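(* Let $z\in\mathcal{Z}$ and let $\zeta^z$ be the bridge from $0$ to $z$ of random length $\tau$ derived from the Lévy process $X$. Assume that for any $\delta>0$ there exists $\hat t=\hat t(\delta)>0$ such that $$C_\delta=\sup_{0<t<\hat t}\ \sup_{|x|>\delta}|f_t(x)|<+\infty.$$ Then: (i) The process $\zeta^z$ is a Markov process with respect to $\mathbb{F}^{\zeta^z,c}_+$, i.e. $\mathbb{E}[g(\zeta^z_u)\mid\mathcal{F}^{\zeta^z,c}_{t^+}]=\mathbb{E}[g(\zeta^z_u)\mid\zeta^z_t]$ $\mathbb{P}$-a.s. for all $0\le t<u$ and every bounded measurable function $g$. (ii) The filtration $\mathbb{F}^{\zeta^z,c}$ satisfies the usual conditions of right-continuity and completeness; in other words, the filtrations $\mathbb{F}^{\zeta^z,c}$ and $\mathbb{F}^{\zeta^z,c}_+$ are identical.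
   Context: $(\Omega,\mathcal{F},\mathbb{P})$ is a complete probability space. $X=(X_t)_{t\ge0}$ is a real-valued symmetric Lévy process with $X_0=0$, with characteristic exponent $\psi$ (so $\mathbb{E}[e^{iuX_t}]=e^{t\psi(u)}$, $\psi$ real-valued), such that $\exp(t\psi)$ is integrable on $\mathbb{R}$ for every $t>0$. Then $X_t$ ($t>0$) has the bounded density $f_t(x)=(2\pi)^{-1}\int_{\mathbb{R}}e^{ixy}e^{t\psi(y)}\,dy$, jointly continuous in $(t,x)\in(0,\infty)\times\mathbb{R}$. Bridge of deterministic length: for $r>0$ and $z\in\mathbb{R}$ with $0<f_r(z)<\infty$, $X^{r,z}$ is the càdlàg process started at $0$ whose finite-dimensional distributions on $(0,r)$ have densities, for $0=t_0<t_1<\dots<t_n<r$ and $x_0=0$, $\frac{f_{r-t_n}(z-x_n)}{f_r(z)}\prod_{i=1}^n f_{t_i-t_{i-1}}(x_i-x_{i-1})$; it is extended by $X^{r,z}_t=z$ for all $t\ge r$. Bridge of random length: $\tau:\Omega\to(0,+\infty)$ is a random time with law $\mathbb{P}_\tau$ and distribution function $F(t)=\mathbb{P}(\tau\le t)$. $\mathcal{Z}$ is the set of $z\in\mathbb{R}$ with $0<f_r(z)<\infty$ for $\mathbb{P}_\tau$-almost every $r$. For $z\in\mathcal{Z}$, a càdlàg process $\zeta^z$ on $(\Omega,\mathcal{F},\mathbb{P})$ is the bridge from $0$ to $z$ of random length $\tau$ derived from $X$ if the conditional distribution of $\zeta^z$ given $\{\tau=r\}$ is the law of $X^{r,z}$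 (on the Skorohod space $\mathbb{D}_\infty$ of càdlàg functions from $[0,+\infty)$ to $\mathbb{R}$). Filtrations: $\mathcal{F}^{\zeta^z}_t=\sigma(\zeta^z_s,\,s\le t)$; $\mathcal{N}_P$ is the collection of $\mathbb{P}$-null sets; $\mathbb{F}^{\zeta^z,c}=(\mathcal{F}^{\zeta^z,c}_t)_{t\ge0}$ with $\mathcal{F}^{\zeta^z,c}_t=\mathcal{F}^{\zeta^z}_t\vee\mathcal{N}_P$ is the completed natural filtration; $\mathbb{F}^{\zeta^z,c}_+=(\mathcal{F}^{\zeta^z,c}_{t^+})_{t\ge0}$ with $\mathcal{F}^{\zeta^z,c}_{t^+}=\bigcap_{s>t}\mathcal{F}^{\zeta^z,c}_s$. *)

theory Defs
  imports "HOL-Probability.Probability"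
begin

text \<open>Time is the half-line \<open>{0..}\<close>; the values of paths and processes at negative times are
  never used.\<close>

definition cadlag :: "(real \<Rightarrow> real) \<Rightarrow> bool" where
  "cadlag w \<longleftrightarrow> (\<forall>t\<ge>0. continuous (at_right t) w) \<and> (\<forall>t>0. \<exists>l. (w \<longlongrightarrow> l) (at_left t))"

text \<open>The Skorohod space with the \<open>\<sigma>\<close>-algebra generated by the coordinate maps, which is
  the Borel \<open>\<sigma>\<close>-algebra of the Skorohod topology. Its points are extensional functions on
  \<open>{0..}\<close>.\<close>

definition skorohod_space :: "(real \<Rightarrow> real) measure" where
  "skorohod_space = restrict_space (\<Pi>\<^sub>M t\<in>{0..}. borel) {w. cadlag w}"

definition path :: "(real \<Rightarrow> 'a \<Rightarrow> real) \<Rightarrow> 'a \<Rightarrow> real \<Rightarrow> real" where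
  "path Y \<omega> = (\<lambda>t\<in>{0..}. Y t \<omega>)"

definition cadlag_process :: "'a measure \<Rightarrow> (real \<Rightarrow> 'a \<Rightarrow> real) \<Rightarrow> bool" where
  "cadlag_process M Y \<longleftrightarrow>
     (\<forall>t\<ge>0. Y t \<in> borel_measurable M) \<and> (\<forall>\<omega>\<in>space M. cadlag (\<lambda>t. Y t \<omega>))"


section \<open>Symmetric Levy processes and their densities\<close>

definition levy_process :: "'a measure \<Rightarrow> (real \<Rightarrow> 'a \<Rightarrow> real) \<Rightarrow> bool" where
  "levy_process M X \<longleftrightarrow>
     prob_space M \<and>
     (\<forall>t\<ge>0. X t \<in> borel_measurable M) \<and>
     (AE \<omega> in M. X 0 \<omega> = 0) \<and>
     (\<forall>n (t :: nat \<Rightarrow> real). 0 \<le> t 0 \<longrightarrow> (\<forall>i<n. t i < t (Suc i)) \<longrightarrow>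
        prob_space.indep_vars M (\<lambda>_. borel) (\<lambda>i \<omega>. X (t (Suc i)) \<omega> - X (t i) \<omega>) {..<n}) \<and>
     (\<forall>s\<ge>0. \<forall>t\<ge>0. distr M borel (\<lambda>\<omega>. X (s + t) \<omega> - X s \<omega>) = distr M borel (X t)) \<and>
     (AE \<omega> in M. cadlag (\<lambda>t. X t \<omega>))"

definition symmetric_process :: "'a measure \<Rightarrow> (real \<Rightarrow> 'a \<Rightarrow> real) \<Rightarrow> bool" where
  "symmetric_process M X \<longleftrightarrow>
     (\<forall>t\<ge>0. distr M borel (\<lambda>\<omega>. - X t \<omega>) = distr M borel (X t))"

definition char_exponent :: "'a measure \<Rightarrow> (real \<Rightarrow> 'a \<Rightarrow> real) \<Rightarrow> (real \<Rightarrow> real) \<Rightarrow> bool" where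
  "char_exponent M X \<psi> \<longleftrightarrow>
     (\<forall>t\<ge>0. \<forall>u. char (distr M borel (X t)) u = complex_of_real (exp (t * \<psi> u)))"

text \<open>\<open>\<psi>\<close> is even, so the integral is real and \<^const>\<open>Re\<close> loses nothing.\<close>

definition levy_density :: "(real \<Rightarrow> real) \<Rightarrow> real \<Rightarrow> real \<Rightarrow> real" where
  "levy_density \<psi> t x =
     Re (CLBINT y. iexp (x * y) * complex_of_real (exp (t * \<psi> y))) / (2 * pi)"


section \<open>Bridges of deterministic and of random length\<close>

text \<open>Density of the finite-dimensional distribution at \<open>0 = t 0 < t 1 < \<dots> < t n < r\<close>; the
  update puts in the convention \<open>x 0 = 0\<close>.\<close>

definition bridge_density ::
    "(real \<Rightarrow> real) \<Rightarrow> real \<Rightarrow> real \<Rightarrow> nat \<Rightarrow> (nat \<Rightarrow> real) \<Rightarrow> (nat \<Rightarrow> real) \<Rightarrow> real" where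
  "bridge_density \<psi> r z n t x' =
     (let x = x'(0 := 0) in
        levy_density \<psi> (r - t n) (z - x n) / levy_density \<psi> r z *
        (\<Prod>i=1..n. levy_density \<psi> (t i - t (i - 1)) (x i - x (i - 1))))"

definition levy_bridge ::
    "(real \<Rightarrow> real) \<Rightarrow> real \<Rightarrow> real \<Rightarrow> 'a measure \<Rightarrow> (real \<Rightarrow> 'a \<Rightarrow> real) \<Rightarrow> bool" where
  "levy_bridge \<psi> r z N Y \<longleftrightarrow>
     0 < r \<and> 0 < levy_density \<psi> r z \<and>
     prob_space N \<and> cadlag_process N Y \<and>
     (AE \<omega> in N. Y 0 \<omega> = 0) \<and>
     (\<forall>n\<ge>1. \<forall>t :: nat \<Rightarrow> real. t 0 = 0 \<longrightarrow> (\<forall>i<n. t i < t (Suc i)) \<longrightarrow> t n < r \<longrightarrow>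
        distributed N (\<Pi>\<^sub>M i\<in>{1..n}. lborel) (\<lambda>\<omega>. \<lambda>i\<in>{1..n}. Y (t i) \<omega>)
          (\<lambda>x. ennreal (bridge_density \<psi> r z n t x))) \<and>
     (AE \<omega> in N. \<forall>t\<ge>r. Y t \<omega> = z)"

text \<open>\<open>\<kappa>\<close> is a regular version of the conditional distribution of \<open>Y\<close> given \<open>T\<close>.\<close>

definition cond_distribution ::
    "'a measure \<Rightarrow> 'b measure \<Rightarrow> ('a \<Rightarrow> 'b) \<Rightarrow> 'c measure \<Rightarrow> ('a \<Rightarrow> 'c) \<Rightarrow> ('c \<Rightarrow> 'b measure) \<Rightarrow> bool"
where
  "cond_distribution M S Y R T \<kappa> \<longleftrightarrow>
     Y \<in> measurable M S \<and> T \<in> measurable M R \<and> \<kappa> \<in> measurable R (prob_algebra S) \<and>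
     (\<forall>A\<in>sets R. \<forall>B\<in>sets S.
        emeasure M {\<omega>\<in>space M. T \<omega> \<in> A \<and> Y \<omega> \<in> B} = (\<integral>\<^sup>+ r\<in>A. emeasure (\<kappa> r) B \<partial>distr M R T))"

text \<open>The requirement \<open>f\<^sub>r(z) < \<infinity>\<close> is automatic, the density being real-valued.\<close>

definition admissible_endpoints :: "'a measure \<Rightarrow> (real \<Rightarrow> real) \<Rightarrow> ('a \<Rightarrow> real) \<Rightarrow> real set" where
  "admissible_endpoints M \<psi> \<tau> = {z. AE r in distr M borel \<tau>. 0 < levy_density \<psi> r z}"

text \<open>A measure on path space is the law of the bridge of length \<open>r\<close> iff the coordinate process
  is such a bridge under it.\<close>

definition random_length_bridge ::
    "'a measure \<Rightarrow> (real \<Rightarrow> real) \<Rightarrow> ('a \<Rightarrow> real) \<Rightarrow> real \<Rightarrow> (real \<Rightarrow> 'a \<Rightarrow> real) \<Rightarrow> bool" where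
  "random_length_bridge M \<psi> \<tau> z \<zeta> \<longleftrightarrow>
     cadlag_process M \<zeta> \<and>
     (\<exists>\<kappa>. cond_distribution M skorohod_space (path \<zeta>) borel \<tau> \<kappa> \<and>
          (AE r in distr M borel \<tau>. levy_bridge \<psi> r z (\<kappa> r) (\<lambda>t w. w t)))"


section \<open>Filtrations and the Markov property\<close>

definition natural_filtration :: "'a measure \<Rightarrow> (real \<Rightarrow> 'a \<Rightarrow> real) \<Rightarrow> real \<Rightarrow> 'a measure" where
  "natural_filtration M Y t =
     sigma (space M) (\<Union>s\<in>{0..t}. {Y s -` A \<inter> space M |A. A \<in> sets borel})"

definition completed_filtration :: "'a measure \<Rightarrow> (real \<Rightarrow> 'a \<Rightarrow> real) \<Rightarrow> real \<Rightarrow> 'a measure" where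
  "completed_filtration M Y t =
     sigma (space M) (sets (natural_filtration M Y t) \<union> null_sets M)"

definition right_limit_filtration :: "(real \<Rightarrow> 'a measure) \<Rightarrow> real \<Rightarrow> 'a measure" where
  "right_limit_filtration F t = sigma (space (F t)) (\<Inter>s\<in>{t<..}. sets (F s))"

lemma space_natural_filtration [simp]: "space (natural_filtration M Y t) = space M"
  by (simp add: natural_filtration_def space_measure_of_conv)

lemma space_completed_filtration [simp]: "space (completed_filtration M Y t) = space M"
  by (simp add: completed_filtration_def space_measure_of_conv)

lemma sets_natural_filtration:
  "sets (natural_filtration M Y t) =
     sigma_sets (space M) (\<Union>s\<in>{0..t}. {Y s -` A \<inter> space M |A. A \<in> sets borel})"
  unfolding natural_filtration_def by (rule sets_measure_of) auto

lemma sets_completed_filtration: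
  "sets (completed_filtration M Y t) =
     sigma_sets (space M) (sets (natural_filtration M Y t) \<union> null_sets M)"
  unfolding completed_filtration_def
proof (rule sets_measure_of)
  show "sets (natural_filtration M Y t) \<union> null_sets M \<subseteq> Pow (space M)"
    using sets.sets_into_space[of _ "natural_filtration M Y t"] sets.sets_into_space[of _ M]
    by auto
qed

lemma sets_right_limit_filtration:
  assumes "\<And>s. space (F s) = \<Omega>"
  shows "sets (right_limit_filtration F t) = (\<Inter>s\<in>{t<..}. sets (F s))"
proof -
  let ?I = "\<Inter>s\<in>{t<..}. sets (F s)"
  have sub: "?I \<subseteq> Pow \<Omega>"
    using sets.sets_into_space[of _ "F (t + 1)"] assms by fastforce
  have "sigma_sets \<Omega> ?I \<subseteq> sets (F s)" if "s > t" for s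
    using sets.sigma_sets_subset[of ?I "F s"] that by (auto simp: assms)
  then have "sigma_sets \<Omega> ?I = ?I"
    by auto
  then show ?thesis
    unfolding right_limit_filtration_def using sub by (simp add: assms)
qed

definition markov_wrt ::
    "'a measure \<Rightarrow> (real \<Rightarrow> 'a measure) \<Rightarrow> (real \<Rightarrow> 'a \<Rightarrow> real) \<Rightarrow> bool" where
  "markov_wrt M F Y \<longleftrightarrow>
     (\<forall>t u. \<forall>g :: real \<Rightarrow> real. 0 \<le> t \<longrightarrow> t < u \<longrightarrow> g \<in> borel_measurable borel \<longrightarrow> bounded (range g) \<longrightarrow>
        (AE \<omega> in M. real_cond_exp M (F t) (\<lambda>\<omega>. g (Y u \<omega>)) \<omega> =
           real_cond_exp M (vimage_algebra (space M) (Y t) borel) (\<lambda>\<omega>. g (Y u \<omega>)) \<omega>))"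

definition usual_conditions :: "'a measure \<Rightarrow> (real \<Rightarrow> 'a measure) \<Rightarrow> bool" where
  "usual_conditions M F \<longleftrightarrow>
     (\<forall>t\<ge>0. sets (F t) = (\<Inter>s\<in>{t<..}. sets (F s))) \<and> (\<forall>t\<ge>0. null_sets M \<subseteq> sets (F t))"

end

theory Submission
  imports Defs
begin

text \<open>
  Given \<open>\<tau> = r\<close>, the bridge on a window \<open>[0, s]\<close> with \<open>s < r\<close> is the Levy process reweighted by
  \<open>f\<^bsub>r-s\<^esub>(z - X\<^sub>s) / f\<^sub>r(z)\<close> (\<open>bridge_law\<close>). Averaging over \<open>r\<close>, the law of \<open>\<zeta>\<close> on \<open>[0, s]\<close>, restricted
  to \<open>{\<tau> \<in> R}\<close> with \<open>R\<close> to the right of \<open>s\<close>, is absolutely continuous with respect to the law of \<open>X\<close>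
  on \<open>[0, s]\<close>, and its density is a function of \<open>X\<^sub>s\<close> alone (\<open>nn_integral_before_length\<close>). So before
  \<open>\<tau>\<close> every question about \<open>\<zeta>\<close> becomes a question about \<open>X\<close>. After \<open>\<tau>\<close> the path rests at \<open>z\<close>; and
  since \<open>X\<^sub>t\<close> has no atoms for \<open>t > 0\<close>, the event \<open>{\<tau> \<le> t}\<close> is almost surely \<open>{\<zeta>\<^sub>t = z}\<close>, hence known
  at time \<open>t\<close>.

  Right-continuity. An event of \<open>\<F>\<^bsub>t+\<^esub>\<close> is almost surely \<open>{\<zeta> \<in> L}\<close> for one set \<open>L\<close> of paths that
  is determined by \<open>[0, t + \<epsilon>]\<close> for every \<open>\<epsilon> > 0\<close>. For the Levy process such an event is almost surely
  an event \<open>{X \<in> L'}\<close> of the past of \<open>t\<close>, because its increments after \<open>t\<close> are independent of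
  \<open>\<F>\<^bsub>t+\<^esub>\<close> (\<open>germ_event_is_past_event\<close>, a form of the zero-one law of Blumenthal). Absolute
  continuity carries the equality of \<open>L\<close> and \<open>L'\<close> from \<open>X\<close> to \<open>\<zeta>\<close> on \<open>{\<tau> > t + \<epsilon>}\<close> for every \<open>\<epsilon>\<close>, hence on
  \<open>{\<tau> > t}\<close>. On \<open>{\<tau> \<le> t}\<close> the whole path is determined by the path stopped at \<open>t\<close>. As \<open>{\<tau> \<le> t}\<close> is itself
  known at \<open>t\<close>, the event belongs to the completed past.

  Markov property. After right-continuity it is enough to condition on the completed past of \<open>t\<close>.
  On \<open>{\<tau> > t}\<close>, both \<open>E[g(\<zeta>\<^sub>u); \<zeta> \<in> B]\<close> and \<open>P(\<zeta> \<in> B)\<close>, for \<open>B\<close> in the past of \<open>t\<close>, are integrals over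
  \<open>{X \<in> B}\<close> of functions of \<open>X\<^sub>t\<close>; their quotient, evaluated at \<open>\<zeta>\<^sub>t\<close>, is the conditional expectation
  (\<open>nonneg_transition_function\<close>). On \<open>{\<tau> \<le> t}\<close> the future is constant.
\<close>

section \<open>Inversion of integrable characteristic functions\<close>

lemma integral_iexp_Icc:
  fixes a b t :: real
  assumes "a \<le> b" "t \<noteq> 0"
  shows "(CLBINT x. indicator {a..b} x *\<^sub>R iexp (- (t * x)))
    = (iexp (- (t * a)) - iexp (- (t * b))) / (\<i> * t)"
proof -
  have "(CLBINT x. indicator {a..b} x *\<^sub>R iexp (- (t * x)))
      = - iexp (- (t * b)) / (\<i> * t) - - iexp (- (t * a)) / (\<i> * t)"
  proof (rule integral_FTC_Icc[OF \<open>a \<le> b\<close>])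
    fix x :: real assume "a \<le> x" "x \<le> b"
    show "((\<lambda>x. - iexp (- (t * x)) / (\<i> * t)) has_vector_derivative iexp (- (t * x)))
        (at x within {a..b})"
      using \<open>t \<noteq> 0\<close>
      by (auto intro!: derivative_eq_intros has_vector_derivative_real_field simp: field_simps)
  qed (auto intro!: continuous_intros)
  then show ?thesis by (simp add: diff_divide_distrib)
qed

context real_distribution
begin

definition inversion_density :: "real \<Rightarrow> real" where
  "inversion_density x = Re (CLBINT t. iexp (- (t * x)) * char M t) / (2 * pi)"

context
  assumes integrable_char: "integrable lborel (char M)"
begin

lemma abs_inversion_density_le:
  "\<bar>inversion_density x\<bar> \<le> (LBINT t. cmod (char M t)) / (2 * pi)"
proof -
  have "\<bar>Re (CLBINT t. iexp (- (t * x)) * char M t)\<bar> \<le> cmod (CLBINT t. iexp (- (t * x)) * char M t)"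
    by (rule abs_Re_le_cmod)
  also have "\<dots> \<le> (LBINT t. cmod (iexp (- (t * x)) * char M t))"
    by (rule integral_norm_bound)
  also have "\<dots> = (LBINT t. cmod (char M t))"
    by (simp add: norm_mult)
  finally show ?thesis
    by (simp add: inversion_density_def divide_right_mono)
qed

lemma continuous_inversion_integral: "continuous_on UNIV (\<lambda>x. CLBINT t. iexp (- (t * x)) * char M t)"
proof -
  have "isCont (\<lambda>x. CLBINT t. iexp (- (t * x)) * char M t) x" for x
    unfolding continuous_at_sequentially
  proof (intro allI impI)
    fix u assume u: "u \<longlonglongrightarrow> x"
    show "((\<lambda>x. CLBINT t. iexp (- (t * x)) * char M t) \<circ> u) \<longlonglongrightarrow> (CLBINT t. iexp (- (t * x)) * char M t)"
      unfolding comp_def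
    proof (rule integral_dominated_convergence[where w="\<lambda>t. cmod (char M t)"])
      show "integrable lborel (\<lambda>t. cmod (char M t))" using integrable_char by simp
      show "AE t in lborel. (\<lambda>n. iexp (- (t * u n)) * char M t) \<longlonglongrightarrow> iexp (- (t * x)) * char M t"
        by (intro AE_I2 tendsto_intros u)
    qed (auto simp: norm_mult)
  qed
  then show ?thesis
    by (simp add: continuous_at_imp_continuous_on)
qed

lemma continuous_inversion_density: "continuous_on UNIV inversion_density"
  unfolding inversion_density_def by (intro continuous_intros continuous_inversion_integral) auto

lemma borel_measurable_inversion_density [measurable]: "inversion_density \<in> borel_measurable borel"
  using continuous_inversion_density by (rule borel_measurable_continuous_onI)

lemma set_integrable_inversion_density: "integrable lborel (\<lambda>x. indicator {a..b} x * inversion_density x)"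
  using borel_integrable_atLeastAtMost'[of a b inversion_density]
    continuous_on_subset[OF continuous_inversion_density]
  by (auto simp: set_integrable_def)

text \<open>Inversion gives the mass of \<open>(a, b]\<close> as a limit of integrals over growing windows. An integrable
  characteristic function dominates the integrand, so the limit is the integral over the whole line,
  and \<open>(iexp (-ta) - iexp (-tb)) / (\<i>t)\<close> is the integral of \<open>iexp (-tx)\<close> over \<open>x \<in> [a, b]\<close>; Fubini
  finishes.\<close>

lemma measure_Ioc_no_atoms:
  assumes "a \<le> b" "measure M {a} = 0" "measure M {b} = 0"
  shows "measure M {a<..b} = (LBINT x. indicator {a..b} x * inversion_density x)"
proof -
  let ?F = "\<lambda>t. (iexp (-(t * a)) - iexp (-(t * b))) / (\<i> * t)"
  have F_bound: "cmod (?F t) \<le> b - a" if "t \<noteq> 0" for t :: real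
    using Levy_Inversion_aux2[of "-b" "-a" t] that assms(1) by simp
  have AE0: "AE t in lborel. (t::real) \<noteq> 0"
    by (rule AE_lborel_singleton)
  have int_F: "integrable lborel (\<lambda>t. ?F t * char M t)"
  proof (rule Bochner_Integration.integrable_bound[where f="\<lambda>t. (b - a) *\<^sub>R char M t"])
    show "AE t in lborel. cmod (?F t * char M t) \<le> cmod ((b - a) *\<^sub>R char M t)"
      using AE0 by eventually_elim
        (use assms(1) in \<open>simp only: norm_mult norm_scaleR abs_of_nonneg diff_ge_0_iff_ge,
            intro mult_right_mono F_bound norm_ge_zero\<close>)
  qed (use integrable_char in auto)
  have interval_eq: "(CLBINT t=- ereal (real T)..ereal (real T). G t) = (CLBINT t. indicat_real {- real T<..<real T} t *\<^sub>R G t)"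
    for T :: nat and G :: "real \<Rightarrow> complex"
    by (simp add: interval_lebesgue_integral_def set_lebesgue_integral_def)
  let ?I = "complex_of_real (1 / (2 * pi)) * (CLBINT t. ?F t * char M t)"
  have "(\<lambda>T::nat. complex_of_real (1 / (2 * pi)) * (CLBINT t=- ereal (real T)..ereal (real T). ?F t * char M t)) \<longlonglongrightarrow> ?I"
  proof (rule tendsto_mult[OF tendsto_const])
    show "(\<lambda>T::nat. CLBINT t=- ereal (real T)..ereal (real T). ?F t * char M t) \<longlonglongrightarrow> (CLBINT t. ?F t * char M t)"
      unfolding interval_eq
    proof (rule integral_dominated_convergence[where w="\<lambda>t. cmod (?F t * char M t)"])
      show "integrable lborel (\<lambda>t. cmod (?F t * char M t))" using int_F by (rule integrable_norm)
      show "AE t in lborel. (\<lambda>n. indicat_real {- real n<..<real n} t *\<^sub>R (?F t * char M t)) \<longlonglongrightarrow> ?F t * char M t"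
      proof (rule AE_I2)
        fix t :: real
        have "eventually (\<lambda>n. \<bar>t\<bar> < real n) sequentially"
          using eventually_gt_at_top[of "nat \<lceil>\<bar>t\<bar>\<rceil>"] by eventually_elim linarith
        then have "eventually (\<lambda>n. indicat_real {- real n<..<real n} t *\<^sub>R (?F t * char M t) = ?F t * char M t) sequentially"
          by eventually_elim (simp add: indicator_def abs_less_iff)
        then show "(\<lambda>n. indicat_real {- real n<..<real n} t *\<^sub>R (?F t * char M t)) \<longlonglongrightarrow> ?F t * char M t"
          by (rule tendsto_eventually)
      qed
    qed (auto simp: indicator_def)
  qed
  moreover have "(\<lambda>T::nat. complex_of_real (1 / (2 * pi)) * (CLBINT t=- ereal (real T)..ereal (real T). ?F t * char M t)) \<longlonglongrightarrow> of_real (measure M {a<..b})"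
    using Levy_Inversion[OF assms] by simp
  ultimately have eq: "complex_of_real (measure M {a<..b}) = ?I"
    using LIMSEQ_unique by blast
  let ?h = "\<lambda>t x. indicator {a..b} x *\<^sub>R (iexp (- (t * x)) * char M t)"
  have "(CLBINT t. ?F t * char M t) = (CLBINT t. CLBINT x. ?h t x)"
  proof (rule integral_cong_AE)
    show "AE t in lborel. ?F t * char M t = (CLBINT x. ?h t x)"
      using AE0
    proof eventually_elim
      case (elim t)
      have "(CLBINT x. ?h t x) = (CLBINT x. (indicator {a..b} x *\<^sub>R iexp (- (t * x))) * char M t)"
        by (intro Bochner_Integration.integral_cong) auto
      also have "\<dots> = (CLBINT x. (indicator {a..b} x *\<^sub>R iexp (- (t * x)))) * char M t"
        by (rule integral_mult_left_zero)
      finally show ?case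
        by (simp only: integral_iexp_Icc[OF assms(1) elim])
    qed
  qed auto
  also have "\<dots> = (CLBINT x. CLBINT t. ?h t x)"
  proof (rule lborel_pair.Fubini_integral[symmetric])
    show "integrable (lborel \<Otimes>\<^sub>M lborel) (\<lambda>(t, x). ?h t x)"
    proof (rule lborel_pair.Fubini_integrable)
      have "(\<lambda>t. LBINT x. norm (case (t, x) of (t, x) \<Rightarrow> ?h t x)) = (\<lambda>t. (b - a) * cmod (char M t))"
        using assms(1) by (auto simp: norm_mult)
      then show "integrable lborel (\<lambda>t. LBINT x. norm (case (t, x) of (t, x) \<Rightarrow> ?h t x))"
        using integrable_char by simp
      show "AE t in lborel. integrable lborel (\<lambda>x. case (t, x) of (t, x) \<Rightarrow> ?h t x)"
        by (intro AE_I2) (simp, rule borel_integrable_atLeastAtMost'[unfolded set_integrable_def], auto intro!: continuous_intros)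
    qed simp
  qed
  also have "\<dots> = (CLBINT x. indicator {a..b} x *\<^sub>R (CLBINT t. iexp (- (t * x)) * char M t))"
    by simp
  finally have "measure M {a<..b} = Re (complex_of_real (1 / (2 * pi)) * \<dots>)"
    using eq by (metis Re_complex_of_real)
  also have "\<dots> = Re (CLBINT x. indicator {a..b} x *\<^sub>R (CLBINT t. iexp (- (t * x)) * char M t)) / (2 * pi)"
    by (simp add: Re_divide_of_real)
  also have "Re (CLBINT x. indicator {a..b} x *\<^sub>R (CLBINT t. iexp (- (t * x)) * char M t)) =
     (LBINT x. Re (indicator {a..b} x *\<^sub>R (CLBINT t. iexp (- (t * x)) * char M t)))"
  proof (rule integral_Re[symmetric])
    have "continuous_on UNIV (\<lambda>x. CLBINT t. iexp (- (t * x)) * char M t)"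
      by (rule continuous_inversion_integral)
    then show "integrable lborel (\<lambda>x. indicator {a..b} x *\<^sub>R (CLBINT t. iexp (- (t * x)) * char M t))"
      by (intro borel_integrable_atLeastAtMost'[unfolded set_integrable_def])
        (auto intro: continuous_on_subset)
  qed
  also have "\<dots> / (2 * pi) = (LBINT x. indicator {a..b} x * inversion_density x)"
    by (simp add: inversion_density_def flip: integral_divide_zero)
  finally show ?thesis .
qed

lemma countable_atoms: "countable {x. measure M {x} \<noteq> 0}"
  by (rule countable_support)

lemma ex_non_atom:
  assumes "a < b"
  obtains x where "a < x" "x < b" "measure M {x} = 0"
proof -
  have "\<not> {a<..<b} \<subseteq> {x. measure M {x} \<noteq> 0}"
    using countable_subset[OF _ countable_atoms] uncountable_open_interval[of a b] assms by blast
  then show ?thesis using that by auto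
qed

text \<open>Enclose \<open>x\<close> in an interval whose endpoints are not atoms. Its mass is at most its length times a
  bound of the density, which tends to \<open>0\<close> with the length.\<close>

lemma no_atoms: "measure M {x} = 0"
proof (rule ccontr)
  assume "measure M {x} \<noteq> 0"
  then have pos: "measure M {x} > 0" by (simp add: zero_less_measure_iff)
  (* The enclosing interval has length below 2e, and e is chosen so that 2eC stays below the
     assumed mass of the atom. *)
  define C where "C = (LBINT t. cmod (char M t)) / (2 * pi)"
  define e where "e = measure M {x} / (4 * (C + 1))"
  have C: "C \<ge> 0" "\<bar>inversion_density y\<bar> \<le> C" for y
    using abs_inversion_density_le by (auto simp: C_def)
  have e: "e > 0" using pos C by (simp add: e_def)
  obtain a where a: "x - e < a" "a < x" "measure M {a} = 0" using ex_non_atom[of "x - e" x] e by auto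
  obtain b where b: "x < b" "b < x + e" "measure M {b} = 0" using ex_non_atom[of x "x + e"] e by auto
  have "measure M {x} \<le> measure M {a<..b}"
    using a b by (intro finite_measure_mono) auto
  also have "\<dots> = (LBINT x. indicator {a..b} x * inversion_density x)"
    using a b by (intro measure_Ioc_no_atoms) auto
  also have "\<dots> \<le> (LBINT x. indicator {a..b} x * C)"
  proof (intro integral_mono set_integrable_inversion_density)
    show "indicator {a..b} y * inversion_density y \<le> indicator {a..b} y * C" for y
      using C(2)[of y] by (auto simp: indicator_def)
  qed (auto simp: emeasure_lborel_Icc_eq intro!: integrable_real_indicator integrable_mult_left)
  also have "\<dots> = (b - a) * C" using a b by simp
  also have "\<dots> \<le> 2 * e * C" using a b C by (intro mult_right_mono) auto
  also have "\<dots> = measure M {x} * (C / (2 * (C + 1)))" using C(1) by (simp add: e_def field_simps)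
  also have "\<dots> < measure M {x} * 1" using pos C(1) by (intro mult_strict_left_mono) (auto simp: field_simps)
  finally show False by simp
qed

lemma measure_Ioc:
  "a \<le> b \<Longrightarrow> measure M {a<..b} = (LBINT x. indicator {a..b} x * inversion_density x)"
  by (intro measure_Ioc_no_atoms no_atoms)

text \<open>A negative value would, by continuity, make the density negative on a whole interval, whose mass
  would then be negative.\<close>

lemma inversion_density_nonneg: "0 \<le> inversion_density x"
proof (rule ccontr)
  assume neg: "\<not> ?thesis"
  define c where "c = - inversion_density x / 2"
  have c: "c > 0" using neg by (simp add: c_def)
  have "isCont inversion_density x"
    using continuous_inversion_density by (simp add: continuous_on_eq_continuous_at)
  then obtain d where d: "d > 0" "\<And>y. \<bar>y - x\<bar> < d \<Longrightarrow> \<bar>inversion_density y - inversion_density x\<bar> < c"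
    unfolding continuous_at_eps_delta dist_real_def using c by (auto simp: real_norm_def)
  have "0 \<le> measure M {x<..x + d/2}" by simp
  also have "\<dots> = (LBINT y. indicator {x..x+d/2} y * inversion_density y)"
    using d by (intro measure_Ioc) auto
  also have "\<dots> \<le> (LBINT y. indicator {x..x+d/2} y * (- c))"
  proof (intro integral_mono set_integrable_inversion_density)
    show "indicator {x..x+d/2} y * inversion_density y \<le> indicator {x..x+d/2} y * (- c)" for y
      using d(2)[of y] d(1) by (auto simp: indicator_def c_def)
  qed (auto simp: emeasure_lborel_Icc_eq intro!: integrable_real_indicator integrable_mult_left)
  also have "\<dots> = - (d / 2 * c)" using d by simp
  finally show False using mult_pos_pos[OF d(1) c] by simp
qed

text \<open>Inversion determines the mass of every half-open interval, and these masses determine the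
  measure on the half-lines.\<close>

theorem density_inversion_density: "M = density lborel (\<lambda>x. ennreal (inversion_density x))"
proof (rule measure_eqI_lessThan)
  have Ioc: "emeasure M {x<..x + real n} = emeasure (density lborel (\<lambda>x. ennreal (inversion_density x))) {x<..x + real n}" for x n
  proof -
    have "emeasure M {x<..x + real n} = ennreal (LBINT y. indicator {x..x + real n} y * inversion_density y)"
      by (simp add: emeasure_eq_measure measure_Ioc)
    also have "\<dots> = (\<integral>\<^sup>+ y. ennreal (indicator {x..x + real n} y * inversion_density y) \<partial>lborel)"
      by (intro nn_integral_eq_integral[symmetric] set_integrable_inversion_density)
        (simp add: inversion_density_nonneg)
    also have "\<dots> = (\<integral>\<^sup>+ y. ennreal (inversion_density y) * indicator {x<..x + real n} y \<partial>lborel)"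
    proof (rule nn_integral_cong_AE)
      show "AE y in lborel. ennreal (indicator {x..x + real n} y * inversion_density y) =
          ennreal (inversion_density y) * indicator {x<..x + real n} y"
        using AE_lborel_singleton[of x] by eventually_elim (auto simp: indicator_def)
    qed
    also have "\<dots> = emeasure (density lborel (\<lambda>x. ennreal (inversion_density x))) {x<..x + real n}"
      by (simp add: emeasure_density)
    finally show ?thesis .
  qed
  have un: "{x<..} = (\<Union>n. {x<..x + real n})" for x :: real
  proof (intro equalityI subsetI)
    fix y assume "y \<in> {x<..}"
    then show "y \<in> (\<Union>n. {x<..x + real n})"
      using real_arch_simple[of "y - x"] by (auto simp: algebra_simps)
  qed auto
  show "emeasure M {x<..} = emeasure (density lborel (\<lambda>x. ennreal (inversion_density x))) {x<..}" for x
    unfolding un by (subst (1 2) SUP_emeasure_incseq[symmetric]) (auto simp: incseq_def Ioc)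
qed (auto simp: emeasure_eq_measure)

end

end

section \<open>Events determined by a set of times\<close>

lemma measurable_event:
  assumes "g \<in> measurable N K" "A \<in> sets K"
  shows "{\<omega>\<in>space N. g \<omega> \<in> A} \<in> sets N"
proof -
  have "{\<omega>\<in>space N. g \<omega> \<in> A} = g -` A \<inter> space N" by auto
  then show ?thesis using measurable_sets[OF assms] by simp
qed

text \<open>Paths are total functions \<open>real \<Rightarrow> real\<close>, and \<open>hist J\<close> lives on all of them whatever \<open>J\<close> is, so that
  the algebras for different windows are comparable by inclusion and a process \<open>Y\<close> is inserted by the
  same map \<open>\<lambda>\<omega> q. Y q \<omega>\<close> for each of them.\<close>

definition hist :: "real set \<Rightarrow> (real \<Rightarrow> real) measure" where
  "hist J = sigma UNIV {{w. w q \<in> A} |q A. q \<in> J \<and> A \<in> sets borel}"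

definition cylinders :: "real set \<Rightarrow> (real \<Rightarrow> real) set set" where
  "cylinders J = {{w. \<forall>q\<in>F. w q \<in> A q} |F A. finite F \<and> F \<subseteq> J \<and> range A \<subseteq> sets borel}"

lemma space_hist [simp]: "space (hist J) = UNIV"
  by (simp add: hist_def space_measure_of_conv)

lemma sets_hist: "sets (hist J) = sigma_sets UNIV {{w. w q \<in> A} |q A. q \<in> J \<and> A \<in> sets borel}"
  unfolding hist_def by (rule sets_measure_of) auto

lemma measurable_hist_coordinate [measurable (raw)]:
  "q \<in> J \<Longrightarrow> (\<lambda>w. w q) \<in> borel_measurable (hist J)"
  by (rule measurableI) (auto simp: sets_hist vimage_def intro!: sigma_sets.Basic)

lemma coordinate_event_in_hist:
  "q \<in> J \<Longrightarrow> A \<in> sets borel \<Longrightarrow> {w. w q \<in> A} \<in> sets (hist J)"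
  unfolding sets_hist by (rule sigma_sets.Basic) blast

lemma sets_hist_mono: "J \<subseteq> K \<Longrightarrow> sets (hist J) \<subseteq> sets (hist K)"
  unfolding sets_hist by (intro sigma_sets_mono') auto

lemma measurable_histI:
  fixes Y :: "'a \<Rightarrow> real \<Rightarrow> real"
  assumes "\<And>q. q \<in> J \<Longrightarrow> (\<lambda>\<omega>. Y \<omega> q) \<in> borel_measurable M"
  shows "Y \<in> measurable M (hist J)"
  unfolding hist_def
proof (rule measurable_measure_of)
  fix B :: "(real \<Rightarrow> real) set" assume "B \<in> {{w. w q \<in> A} |q A. q \<in> J \<and> A \<in> sets borel}"
  then obtain q A where "B = {w. w q \<in> A}" "q \<in> J" "A \<in> sets borel" by auto
  then show "Y -` B \<inter> space M \<in> sets M"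
    using measurable_sets[OF assms[of q]] by (simp add: vimage_def)
qed auto

lemma hist_determined:
  assumes "B \<in> sets (hist J)" "\<And>q. q \<in> J \<Longrightarrow> w q = w' q"
  shows "w \<in> B \<longleftrightarrow> w' \<in> B"
  using assms(1) unfolding sets_hist
  by (induction) (use assms(2) in auto)

lemma Int_stable_cylinders: "Int_stable (cylinders J)"
proof (rule Int_stableI)
  fix a b assume "a \<in> cylinders J" "b \<in> cylinders J"
  then obtain F A G B where a: "a = {w. \<forall>q\<in>F. w q \<in> A q}" "finite F" "F \<subseteq> J" "range A \<subseteq> sets borel"
    and b: "b = {w. \<forall>q\<in>G. w q \<in> B q}" "finite G" "G \<subseteq> J" "range B \<subseteq> sets borel"
    unfolding cylinders_def by auto
  have "a \<inter> b = {w. \<forall>q\<in>F \<union> G. w q \<in> (if q \<in> F then A q else UNIV) \<inter> (if q \<in> G then B q else UNIV)}"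
    unfolding a b by auto
  moreover have "range (\<lambda>q. (if q \<in> F then A q else UNIV) \<inter> (if q \<in> G then B q else UNIV)) \<subseteq> sets borel"
    using a b by auto
  ultimately show "a \<inter> b \<in> cylinders J"
    unfolding cylinders_def mem_Collect_eq
    using a b by (intro exI[of _ "F \<union> G"] exI[of _ "\<lambda>q. (if q \<in> F then A q else UNIV) \<inter> (if q \<in> G then B q else UNIV)"]) auto
qed

lemma cylinders_subset_hist: "cylinders J \<subseteq> sets (hist J)"
proof
  fix a assume "a \<in> cylinders J"
  then obtain F A where a: "a = {w. \<forall>q\<in>F. w q \<in> A q}" "finite F" "F \<subseteq> J" "range A \<subseteq> sets borel"
    unfolding cylinders_def by auto
  have "{w \<in> space (hist J). \<forall>q\<in>F. w q \<in> A q} \<in> sets (hist J)"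
  proof (intro sets.sets_Collect_finite_All a)
    show "{w \<in> space (hist J). w q \<in> A q} \<in> sets (hist J)" if "q \<in> F" for q
    proof -
      have "q \<in> J" "A q \<in> sets borel" using that a by auto
      then show ?thesis by (auto simp: sets_hist intro!: sigma_sets.Basic)
    qed
  qed
  then show "a \<in> sets (hist J)" by (simp add: a)
qed

lemma sets_hist_cylinders: "sets (hist J) = sigma_sets UNIV (cylinders J)"
proof
  show "sets (hist J) \<subseteq> sigma_sets UNIV (cylinders J)"
    unfolding sets_hist
  proof (rule sigma_sets_mono', safe)
    fix q :: real and A :: "real set" assume "q \<in> J" "A \<in> sets borel"
    then show "{w. w q \<in> A} \<in> cylinders J"
      unfolding cylinders_def by (intro CollectI exI[of _ "{q}"] exI[of _ "\<lambda>_. A"]) auto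
  qed
  show "sigma_sets UNIV (cylinders J) \<subseteq> sets (hist J)"
    using sets.sigma_sets_subset[OF cylinders_subset_hist[of J]] by simp
qed

lemma hist_measure_eqI:
  assumes "sets \<mu> = sets (hist J)" "sets \<nu> = sets (hist J)" "emeasure \<mu> UNIV \<noteq> \<infinity>"
    and "\<And>F A. finite F \<Longrightarrow> F \<subseteq> J \<Longrightarrow> (\<And>q. A q \<in> sets borel) \<Longrightarrow>
      emeasure \<mu> {w. \<forall>q\<in>F. w q \<in> A q} = emeasure \<nu> {w. \<forall>q\<in>F. w q \<in> A q}"
  shows "\<mu> = \<nu>"
proof (rule measure_eqI_generator_eq[OF Int_stable_cylinders[of J], where \<Omega>=UNIV and A="\<lambda>_. UNIV"])
  show "range (\<lambda>_::nat. UNIV) \<subseteq> cylinders J"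
    unfolding cylinders_def by (auto intro!: exI[of _ "{}"] exI[of _ "\<lambda>_. {}"])
  show "emeasure \<mu> B = emeasure \<nu> B" if "B \<in> cylinders J" for B
    using that assms(4) unfolding cylinders_def by auto
qed (use assms in \<open>auto simp: sets_hist_cylinders\<close>)

lemma sets_natural_filtration_iff:
  "A \<in> sets (natural_filtration M Y t) \<longleftrightarrow>
    (\<exists>B\<in>sets (hist {0..t}). A = {\<omega>\<in>space M. (\<lambda>q. Y q \<omega>) \<in> B})"
proof -
  let ?Y = "\<lambda>\<omega> q. Y q \<omega>" and ?G = "{{w. w q \<in> A} |q A. q \<in> {0..t} \<and> A \<in> sets (borel :: real measure)}"
  have "sets (natural_filtration M Y t) = sigma_sets (space M) {?Y -` B \<inter> space M |B. B \<in> ?G}"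
    unfolding sets_natural_filtration
  proof (rule arg_cong[where f="sigma_sets _"], intro set_eqI iffI)
    fix x assume "x \<in> (\<Union>s\<in>{0..t}. {Y s -` A \<inter> space M |A. A \<in> sets borel})"
    then obtain s A where "s \<in> {0..t}" "A \<in> sets borel" "x = Y s -` A \<inter> space M" by auto
    then show "x \<in> {?Y -` B \<inter> space M |B. B \<in> ?G}"
      by (intro CollectI exI[of _ "{w. w s \<in> A}"]) auto
  next
    fix x assume "x \<in> {?Y -` B \<inter> space M |B. B \<in> ?G}"
    then obtain s A where "s \<in> {0..t}" "A \<in> sets borel" "x = ?Y -` {w. w s \<in> A} \<inter> space M" by auto
    then show "x \<in> (\<Union>s\<in>{0..t}. {Y s -` A \<inter> space M |A. A \<in> sets borel})"
      by (auto simp: vimage_def)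
  qed
  also have "\<dots> = {?Y -` B \<inter> space M |B. B \<in> sets (hist {0..t})}"
    unfolding sets_hist by (rule sigma_sets_vimage_commute[symmetric]) auto
  finally show ?thesis by (auto simp: vimage_def Int_def conj_commute)
qed

text \<open>Almost sure equivalence of two events, in the form in which completions are built.\<close>

lemma AE_iff_equiv_null:
  assumes "A \<in> sets M" "B \<in> sets M"
  shows "(AE \<omega> in M. \<omega> \<in> A \<longleftrightarrow> \<omega> \<in> B) \<longleftrightarrow> A - B \<in> null_sets M \<and> B - A \<in> null_sets M"
proof -
  have "(AE \<omega> in M. \<omega> \<in> A \<longleftrightarrow> \<omega> \<in> B) \<longleftrightarrow> (AE \<omega> in M. \<omega> \<notin> A - B) \<and> (AE \<omega> in M. \<omega> \<notin> B - A)"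
    unfolding AE_conj_iff[symmetric] by (intro AE_cong) auto
  then show ?thesis
    using assms by (simp add: AE_iff_null_sets)
qed

text \<open>The events that agree almost surely with an event of the past form a \<open>\<sigma>\<close>-algebra, which is the
  completion. In this form an event of the completed filtration is represented by a set of paths, which
  can then be inserted into another process.\<close>

lemma sets_completed_filtration_iff:
  assumes "\<And>q. 0 \<le> q \<Longrightarrow> Y q \<in> borel_measurable M"
  shows "A \<in> sets (completed_filtration M Y t) \<longleftrightarrow>
    A \<in> sets M \<and> (\<exists>B\<in>sets (hist {0..t}). AE \<omega> in M. \<omega> \<in> A \<longleftrightarrow> (\<lambda>q. Y q \<omega>) \<in> B)"
    (is "_ \<longleftrightarrow> ?R A")
proof -
  let ?Y = "\<lambda>\<omega> q. Y q \<omega>"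
  let ?F = "sigma_sets (space M) (sets (natural_filtration M Y t) \<union> null_sets M)"
  have Ymeas: "{\<omega>\<in>space M. ?Y \<omega> \<in> B} \<in> sets M" if "B \<in> sets (hist {0..t})" for B
    using measurable_sets[OF measurable_histI[of "{0..t}" ?Y M] that] assms
    by (simp add: vimage_def Int_def conj_commute)
  have "?R A" if "A \<in> ?F"
    using that
  proof induction
    case (Basic a)
    show ?case
    proof (cases "a \<in> null_sets M")
      case True
      then show ?thesis
        by (intro conjI bexI[of _ "{}"]) (auto intro: AE_not_in)
    next
      case False
      then obtain B where B: "B \<in> sets (hist {0..t})" "a = {\<omega>\<in>space M. ?Y \<omega> \<in> B}"
        using Basic by (auto simp: sets_natural_filtration_iff)
      then show ?thesis
        by (intro conjI bexI[of _ B]) (auto intro: Ymeas)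
    qed
  next
    case Empty
    show ?case by (intro conjI bexI[of _ "{}"]) auto
  next
    case (Compl a)
    then obtain B where B: "B \<in> sets (hist {0..t})" "AE \<omega> in M. \<omega> \<in> a \<longleftrightarrow> ?Y \<omega> \<in> B"
      and a: "a \<in> sets M" by auto
    have "AE \<omega> in M. \<omega> \<in> space M - a \<longleftrightarrow> ?Y \<omega> \<in> UNIV - B"
      using B(2) AE_space by eventually_elim auto
    moreover have "UNIV - B \<in> sets (hist {0..t})"
      using sets.compl_sets[OF B(1)] by simp
    ultimately show ?case using a by blast
  next
    case (Union a)
    then have "\<forall>i. \<exists>B\<in>sets (hist {0..t}). AE \<omega> in M. \<omega> \<in> a i \<longleftrightarrow> ?Y \<omega> \<in> B" by auto
    then obtain B where B: "\<And>i. B i \<in> sets (hist {0..t})" "\<And>i. AE \<omega> in M. \<omega> \<in> a i \<longleftrightarrow> ?Y \<omega> \<in> B i"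
      by metis
    have "AE \<omega> in M. \<forall>i. \<omega> \<in> a i \<longleftrightarrow> ?Y \<omega> \<in> B i"
      using B(2) by (simp add: AE_all_countable)
    then have "AE \<omega> in M. \<omega> \<in> (\<Union>i. a i) \<longleftrightarrow> ?Y \<omega> \<in> (\<Union>i. B i)"
      by eventually_elim auto
    then show ?case
      using Union.IH B(1) by (intro conjI bexI[of _ "\<Union>i. B i"]) auto
  qed
  moreover have "A \<in> ?F" if R: "?R A"
  proof -
    obtain B where B: "B \<in> sets (hist {0..t})" and AE: "AE \<omega> in M. \<omega> \<in> A \<longleftrightarrow> ?Y \<omega> \<in> B" and A: "A \<in> sets M"
      using R by auto
    let ?B = "{\<omega>\<in>space M. ?Y \<omega> \<in> B}"
    have "AE \<omega> in M. \<omega> \<in> A \<longleftrightarrow> \<omega> \<in> ?B"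
      using AE AE_space by eventually_elim auto
    then have null: "A - ?B \<in> null_sets M" "?B - A \<in> null_sets M"
      using AE_iff_equiv_null[OF A Ymeas[OF B]] by auto
    interpret F: sigma_algebra "space M" ?F
      by (rule sigma_algebra_sigma_sets)
        (use sets.sets_into_space[of _ M] sets.sets_into_space[of _ "natural_filtration M Y t"] in auto)
    have "?B \<in> ?F" using B by (auto intro!: sigma_sets.Basic simp: sets_natural_filtration_iff)
    moreover have "A - ?B \<in> ?F" "?B - A \<in> ?F" using null by (auto intro!: sigma_sets.Basic)
    ultimately have "(?B - (?B - A)) \<union> (A - ?B) \<in> ?F" by blast
    also have "(?B - (?B - A)) \<union> (A - ?B) = A" using sets.sets_into_space[OF A] by auto
    finally show ?thesis .
  qed
  ultimately show ?thesis unfolding sets_completed_filtration by blast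
qed

text \<open>Independence of increments and the densities of bridges are stated for increasing sequences of times
  starting at \<open>0\<close>, whereas cylinders carry unordered finite sets of times.\<close>

lemma ex_increasing_enumeration:
  fixes F :: "real set"
  assumes "finite F" "0 \<in> F" "F \<subseteq> {0..}"
  shows "\<exists>(n::nat) t. t 0 = 0 \<and> (\<forall>i j. i < j \<longrightarrow> j \<le> n \<longrightarrow> t i < t j) \<and> t ` {..n} = F"
proof -
  let ?l = "sorted_list_of_set F"
  define n where "n = card F - 1"
  have card: "length ?l = Suc n" 
    using assms card_gt_0_iff[of F] by (auto simp: n_def)
  have mono: "?l ! i < ?l ! j" if "i < j" "j \<le> n" for i j
    using that card strict_sorted_list_of_set[of F] by (auto simp: sorted_wrt_iff_nth_less)
  have im: "(!) ?l ` {..n} = F"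
  proof -
    have "F = set ?l" using assms by simp
    also have "\<dots> = (!) ?l ` {..n}" 
      using card by (auto simp: set_conv_nth less_Suc_eq_le)
    finally show ?thesis by simp
  qed
  have "?l ! 0 = 0"
  proof -
    obtain i where i: "i \<le> n" "?l ! i = 0" using im assms(2) by (metis atMost_iff imageE)
    have "?l ! 0 \<in> F" using im by auto
    then have "?l ! 0 \<ge> 0" using assms by auto
    then show ?thesis using mono[of 0 i] i by (cases "i = 0") auto
  qed
  then show ?thesis using mono im by blast
qed

section \<open>Levy processes with transition densities\<close>

text \<open>The process starts at \<open>0\<close> and is right-continuous on every path, not only on almost every path;
  thus limits of its values are measurable with respect to any \<open>\<sigma>\<close>-algebra that makes the values
  measurable, complete or not.\<close>

locale levy_with_density = prob_space M
  for M :: "'a measure" and X :: "real \<Rightarrow> 'a \<Rightarrow> real" and \<psi> :: "real \<Rightarrow> real" +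
  assumes X_measurable: "0 \<le> t \<Longrightarrow> X t \<in> borel_measurable M"
    and X_0: "\<omega> \<in> space M \<Longrightarrow> X 0 \<omega> = 0"
    and X_right_continuous: "0 \<le> t \<Longrightarrow> \<omega> \<in> space M \<Longrightarrow> continuous (at_right t) (\<lambda>t. X t \<omega>)"
    and independent_increments: "0 \<le> v 0 \<Longrightarrow> (\<And>i. i < n \<Longrightarrow> v i < v (Suc i)) \<Longrightarrow>
      indep_vars (\<lambda>_. borel) (\<lambda>i \<omega>. X (v (Suc i)) \<omega> - X (v i) \<omega>) {..<n}"
    and increment_density: "0 \<le> a \<Longrightarrow> 0 < s \<Longrightarrow>
      distr M borel (\<lambda>\<omega>. X (a + s) \<omega> - X a \<omega>) = density lborel (\<lambda>x. ennreal (levy_density \<psi> s x))"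
    and density_nonneg: "0 < s \<Longrightarrow> 0 \<le> levy_density \<psi> s x"
    and exponent_measurable: "\<psi> \<in> borel_measurable borel"
begin

abbreviation f :: "real \<Rightarrow> real \<Rightarrow> real" where "f \<equiv> levy_density \<psi>"

lemma density_measurable [measurable]: "(\<lambda>(t, x). f t x) \<in> borel_measurable (borel \<Otimes>\<^sub>M borel)"
proof -
  note exponent_measurable [measurable]
  show ?thesis
    unfolding levy_density_def by measurable
qed

lemma density_measurable' [measurable (raw)]:
  assumes [measurable]: "g \<in> borel_measurable N" "h \<in> borel_measurable N"
  shows "(\<lambda>x. f (g x) (h x)) \<in> borel_measurable N"
proof -
  have "(\<lambda>x. case (g x, h x) of (t, x) \<Rightarrow> f t x) \<in> borel_measurable N"
    by measurable
  then show ?thesis by simp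
qed

lemma path_measurable: "J \<subseteq> {0..} \<Longrightarrow> (\<lambda>\<omega> q. X q \<omega>) \<in> measurable M (hist J)"
  by (rule measurable_histI) (auto intro: X_measurable)

lemma increments_measurable:
  "0 \<le> a \<Longrightarrow> J \<subseteq> {0..} \<Longrightarrow> (\<lambda>\<omega> q. X q \<omega> - X a \<omega>) \<in> measurable M (hist J)"
  by (rule measurable_histI) (auto intro!: X_measurable borel_measurable_diff)

lemma sum_increments:
  fixes t :: "nat \<Rightarrow> real"
  shows "k \<le> j \<Longrightarrow> (\<Sum>i\<in>{k..<j}. X (t (Suc i)) \<omega> - X (t i) \<omega>) = X (t j) \<omega> - X (t k) \<omega>"
  by (induction j rule: dec_induct) auto

text \<open>List all the times involved, together with \<open>0\<close> and \<open>a = t k\<close>, in increasing order. The values up to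
  \<open>a\<close> are partial sums of the first \<open>k\<close> increments, the increments from \<open>a\<close> on are sums of the remaining
  ones, and disjoint groups of independent variables are independent.\<close>

lemma indep_cylinders:
  assumes "0 \<le> a" "finite F" "F \<subseteq> {0..a}" "finite G" "G \<subseteq> {a..}"
    and A: "\<And>q. A q \<in> sets borel" and C: "\<And>q. C q \<in> sets borel"
  shows "prob ({\<omega>\<in>space M. \<forall>q\<in>F. X q \<omega> \<in> A q} \<inter> {\<omega>\<in>space M. \<forall>q\<in>G. X q \<omega> - X a \<omega> \<in> C q})
    = prob {\<omega>\<in>space M. \<forall>q\<in>F. X q \<omega> \<in> A q} * prob {\<omega>\<in>space M. \<forall>q\<in>G. X q \<omega> - X a \<omega> \<in> C q}"
proof -
  have "finite (F \<union> G \<union> {0, a})" "0 \<in> F \<union> G \<union> {0, a}" "F \<union> G \<union> {0, a} \<subseteq> {0..}"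
    using assms(1-5) by auto
  from ex_increasing_enumeration[OF this] obtain n :: nat and t
    where "t 0 = 0 \<and> (\<forall>i j. i < j \<longrightarrow> j \<le> n \<longrightarrow> t i < t j) \<and> t ` {..n} = F \<union> G \<union> {0, a}"
    by blast
  then have t: "t 0 = 0" "\<And>i j. i < j \<Longrightarrow> j \<le> n \<Longrightarrow> t i < t j" "t ` {..n} = F \<union> G \<union> {0, a}"
    by simp_all
  have t_le: "t i \<le> t j \<longleftrightarrow> i \<le> j" if "i \<le> n" "j \<le> n" for i j :: nat
    using t(2)[of i j] t(2)[of j i] that by (cases i j rule: linorder_cases) auto
  obtain k where k: "k \<le> n" "t k = a" using t(3) by (metis UnI2 atMost_iff imageE insert_iff)
  let ?inc = "\<lambda>i \<omega>. X (t (Suc i)) \<omega> - X (t i) \<omega>"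
  have inc: "indep_vars (\<lambda>_. borel) ?inc {..<n}"
    using t by (intro independent_increments) auto
  have "{..<k} \<inter> {k..<n} = {}" "{..<k} \<subseteq> {..<n}" "{k..<n} \<subseteq> {..<n}"
    using k by auto
  from indep_var_restrict[OF inc this]
  have iv: "indep_var (PiM {..<k} (\<lambda>_. borel)) (\<lambda>\<omega>. restrict (\<lambda>i. ?inc i \<omega>) {..<k})
                 (PiM {k..<n} (\<lambda>_. borel)) (\<lambda>\<omega>. restrict (\<lambda>i. ?inc i \<omega>) {k..<n})" .
  define SA where "SA = {y\<in>space (PiM {..<k} (\<lambda>_. borel :: real measure)). \<forall>j\<in>{..k}. t j \<in> F \<longrightarrow> (\<Sum>i<j. y i) \<in> A (t j)}"
  define SC where "SC = {y\<in>space (PiM {k..<n} (\<lambda>_. borel :: real measure)). \<forall>j\<in>{k..n}. t j \<in> G \<longrightarrow> (\<Sum>i\<in>{k..<j}. y i) \<in> C (t j)}"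
  have SA: "SA \<in> sets (PiM {..<k} (\<lambda>_. borel))"
    unfolding SA_def
  proof (intro sets.sets_Collect_finite_All sets.sets_Collect_imp sets.sets_Collect_const)
    fix j assume "j \<in> {..k}"
    then have "(\<lambda>y. \<Sum>i<j. y i) \<in> borel_measurable (PiM {..<k} (\<lambda>_. borel :: real measure))"
      by (intro borel_measurable_sum) (auto intro!: measurable_component_singleton)
    from measurable_sets[OF this A[of "t j"]]
    show "{y \<in> space (PiM {..<k} (\<lambda>_. borel)). (\<Sum>i<j. y i) \<in> A (t j)} \<in> sets (PiM {..<k} (\<lambda>_. borel))"
      by (simp add: vimage_def Int_def conj_commute)
  qed simp
  have SC: "SC \<in> sets (PiM {k..<n} (\<lambda>_. borel))"
    unfolding SC_def
  proof (intro sets.sets_Collect_finite_All sets.sets_Collect_imp sets.sets_Collect_const)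
    fix j assume "j \<in> {k..n}"
    then have "(\<lambda>y. \<Sum>i\<in>{k..<j}. y i) \<in> borel_measurable (PiM {k..<n} (\<lambda>_. borel :: real measure))"
      by (intro borel_measurable_sum) (auto intro!: measurable_component_singleton)
    from measurable_sets[OF this C[of "t j"]]
    show "{y \<in> space (PiM {k..<n} (\<lambda>_. borel)). (\<Sum>i\<in>{k..<j}. y i) \<in> C (t j)} \<in> sets (PiM {k..<n} (\<lambda>_. borel))"
      by (simp add: vimage_def Int_def conj_commute)
  qed simp
  have FG: "F = t ` {j\<in>{..k}. t j \<in> F}" "G = t ` {j\<in>{k..n}. t j \<in> G}"
  proof -
    have "\<exists>j\<le>k. t j = q" if "q \<in> F" for q
    proof -
      obtain j where "j \<le> n" "t j = q" using t(3) \<open>q \<in> F\<close> by (metis UnI1 atMost_iff imageE)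
      then show ?thesis using t_le[of j k] k assms(3) that by (intro exI[of _ j]) auto
    qed
    then show "F = t ` {j\<in>{..k}. t j \<in> F}" by force
    have "\<exists>j. k \<le> j \<and> j \<le> n \<and> t j = q" if "q \<in> G" for q
    proof -
      obtain j where "j \<le> n" "t j = q" using t(3) \<open>q \<in> G\<close> by (metis UnI1 UnI2 atMost_iff imageE)
      then show ?thesis using t_le[of k j] k assms(5) that by (intro exI[of _ j]) auto
    qed
    then show "G = t ` {j\<in>{k..n}. t j \<in> G}" by force
  qed
  have evA: "{\<omega>\<in>space M. \<forall>q\<in>F. X q \<omega> \<in> A q} = (\<lambda>\<omega>. restrict (\<lambda>i. ?inc i \<omega>) {..<k}) -` SA \<inter> space M"
  proof -
    have "(\<forall>q\<in>F. X q \<omega> \<in> A q) \<longleftrightarrow> restrict (\<lambda>i. ?inc i \<omega>) {..<k} \<in> SA" if "\<omega> \<in> space M" for \<omega>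
    proof -
      have "(\<Sum>i<j. restrict (\<lambda>i. ?inc i \<omega>) {..<k} i) = X (t j) \<omega>" if "j \<le> k" for j
      proof -
        have "(\<Sum>i<j. restrict (\<lambda>i. ?inc i \<omega>) {..<k} i) = (\<Sum>i\<in>{0..<j}. ?inc i \<omega>)"
          using that by (intro sum.cong) auto
        then show ?thesis using X_0[OF \<open>\<omega> \<in> space M\<close>] by (simp add: sum_increments t(1))
      qed
      then show ?thesis
        unfolding SA_def by (subst FG(1)) (auto simp: space_PiM)
    qed
    then show ?thesis by auto
  qed
  have evC: "{\<omega>\<in>space M. \<forall>q\<in>G. X q \<omega> - X a \<omega> \<in> C q} = (\<lambda>\<omega>. restrict (\<lambda>i. ?inc i \<omega>) {k..<n}) -` SC \<inter> space M"
  proof -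
    have "(\<forall>q\<in>G. X q \<omega> - X a \<omega> \<in> C q) \<longleftrightarrow> restrict (\<lambda>i. ?inc i \<omega>) {k..<n} \<in> SC" for \<omega>
    proof -
      have "(\<Sum>i\<in>{k..<j}. restrict (\<lambda>i. ?inc i \<omega>) {k..<n} i) = X (t j) \<omega> - X a \<omega>" if "k \<le> j" "j \<le> n" for j
      proof -
        have "(\<Sum>i\<in>{k..<j}. restrict (\<lambda>i. ?inc i \<omega>) {k..<n} i) = (\<Sum>i\<in>{k..<j}. ?inc i \<omega>)"
          using that by (intro sum.cong) auto
        then show ?thesis using that by (simp add: sum_increments k)
      qed
      then show ?thesis
        unfolding SC_def by (subst FG(2)) (auto simp: space_PiM)
    qed
    then show ?thesis by auto
  qed
  have "{\<omega>\<in>space M. \<forall>q\<in>F. X q \<omega> \<in> A q} \<inter> {\<omega>\<in>space M. \<forall>q\<in>G. X q \<omega> - X a \<omega> \<in> C q}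
    = (\<lambda>\<omega>. (restrict (\<lambda>i. ?inc i \<omega>) {..<k}, restrict (\<lambda>i. ?inc i \<omega>) {k..<n})) -` (SA \<times> SC) \<inter> space M"
    unfolding evA evC by auto
  then show ?thesis
    using indep_varD[OF iv SA SC] unfolding evA evC by simp
qed

lemma past_indep_increments:
  assumes "0 \<le> a" "A \<in> sets (hist {0..a})" "C \<in> sets (hist {a..})"
  shows "prob ({\<omega>\<in>space M. (\<lambda>q. X q \<omega>) \<in> A} \<inter> {\<omega>\<in>space M. (\<lambda>q. X q \<omega> - X a \<omega>) \<in> C})
    = prob {\<omega>\<in>space M. (\<lambda>q. X q \<omega>) \<in> A} * prob {\<omega>\<in>space M. (\<lambda>q. X q \<omega> - X a \<omega>) \<in> C}"
proof -
  let ?X = "\<lambda>\<omega> q. X q \<omega>" and ?I = "\<lambda>\<omega> q. X q \<omega> - X a \<omega>"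
  let ?GA = "{?X -` A \<inter> space M |A. A \<in> cylinders {0..a}}"
  let ?GC = "{?I -` C \<inter> space M |C. C \<in> cylinders {a..}}"
  have stable: "Int_stable {Y -` A \<inter> space M |A. A \<in> cylinders J}" for Y :: "'a \<Rightarrow> real \<Rightarrow> real" and J
  proof (rule Int_stableI, safe)
    fix b c assume "b \<in> cylinders J" "c \<in> cylinders J"
    then have "b \<inter> c \<in> cylinders J" using Int_stable_cylinders by (auto simp: Int_stable_def)
    then show "\<exists>d. (Y -` b \<inter> space M) \<inter> (Y -` c \<inter> space M) = Y -` d \<inter> space M \<and> d \<in> cylinders J"
      by (intro exI[of _ "b \<inter> c"]) auto
  qed
  have "indep_set ?GA ?GC"
  proof (rule indep_setI)
    show "?GA \<subseteq> events"
      using cylinders_subset_hist[of "{0..a}"] path_measurable[of "{0..a}"] by (auto intro: measurable_sets)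
    show "?GC \<subseteq> events"
      using cylinders_subset_hist[of "{a..}"] increments_measurable[OF assms(1), of "{a..}"] assms(1) 
      by (auto intro: measurable_sets)
    fix b c assume "b \<in> ?GA" "c \<in> ?GC"
    then obtain B D where "b = ?X -` B \<inter> space M" "B \<in> cylinders {0..a}" 
      "c = ?I -` D \<inter> space M" "D \<in> cylinders {a..}" by auto
    then obtain F A' G C' where 
      b: "b = ?X -` {w. \<forall>q\<in>F. w q \<in> A' q} \<inter> space M" "finite F" "F \<subseteq> {0..a}" "\<And>q. A' q \<in> sets borel"
      and c: "c = ?I -` {w. \<forall>q\<in>G. w q \<in> C' q} \<inter> space M" "finite G" "G \<subseteq> {a..}" "\<And>q. C' q \<in> sets borel"
      unfolding cylinders_def by auto
    have "b = {\<omega>\<in>space M. \<forall>q\<in>F. X q \<omega> \<in> A' q}" "c = {\<omega>\<in>space M. \<forall>q\<in>G. X q \<omega> - X a \<omega> \<in> C' q}"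
      unfolding b c by auto
    then show "prob (b \<inter> c) = prob b * prob c"
      using indep_cylinders[OF assms(1) b(2,3) c(2,3), of A' C'] b(4) c(4) by simp
  qed
  then have "indep_set (sigma_sets (space M) ?GA) (sigma_sets (space M) ?GC)"
    by (rule indep_set_sigma_sets) (rule stable)+
  moreover have "?X -` A \<inter> space M \<in> sigma_sets (space M) ?GA"
    using assms(2) unfolding sets_hist_cylinders
    by (subst sigma_sets_vimage_commute[where \<Omega>'=UNIV, symmetric]) auto
  moreover have "?I -` C \<inter> space M \<in> sigma_sets (space M) ?GC"
    using assms(3) unfolding sets_hist_cylinders
    by (subst sigma_sets_vimage_commute[where \<Omega>'=UNIV, symmetric]) auto
  ultimately have "prob ((?X -` A \<inter> space M) \<inter> (?I -` C \<inter> space M)) = prob (?X -` A \<inter> space M) * prob (?I -` C \<inter> space M)"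
    by (rule indep_setD)
  then show ?thesis by (simp add: vimage_def Int_def conj_commute)
qed

text \<open>The increment \<open>X\<^sub>u - X\<^sub>a\<close> is independent of the past of \<open>a\<close> and has density \<open>f\<^bsub>u-a\<^esub>\<close>, so the path up to
  \<open>a\<close> and the increment have a product law. The substitution \<open>y \<mapsto> y - X\<^sub>a\<close> in the inner integral gives
  the transition density.\<close>

lemma expectation_given_past:
  assumes "0 \<le> a" "a < u" and A [measurable]: "A \<in> sets (hist {0..a})"
    and \<phi> [measurable]: "\<phi> \<in> borel_measurable borel"
  shows "(\<integral>\<^sup>+\<omega>. indicator A (\<lambda>q. X q \<omega>) * \<phi> (X u \<omega>) \<partial>M)
    = (\<integral>\<^sup>+\<omega>. indicator A (\<lambda>q. X q \<omega>) * (\<integral>\<^sup>+y. ennreal (f (u - a) (y - X a \<omega>)) * \<phi> y \<partial>lborel) \<partial>M)"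
proof -
  let ?X = "\<lambda>\<omega> q. X q \<omega>" and ?i = "\<lambda>\<omega>. X u \<omega> - X a \<omega>"
  have [measurable]: "?X \<in> measurable M (hist {0..a})" by (rule path_measurable) auto
  have [measurable]: "X a \<in> borel_measurable M" "X u \<in> borel_measurable M"
    using assms by (auto intro: X_measurable)
  have [measurable]: "(\<lambda>w. w a) \<in> borel_measurable (hist {0..a})"
    using assms by (intro measurable_hist_coordinate) auto
  let ?P = "distr M (hist {0..a}) ?X" and ?I = "distr M borel ?i"
  interpret P: prob_space ?P by (rule prob_space_distr) simp
  interpret I: prob_space ?I by (rule prob_space_distr) simp
  have joint: "?P \<Otimes>\<^sub>M ?I = distr M (hist {0..a} \<Otimes>\<^sub>M borel) (\<lambda>\<omega>. (?X \<omega>, ?i \<omega>))"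
  proof (rule pair_measure_eqI)
    fix B D assume "B \<in> sets ?P" "D \<in> sets ?I"
    then have B [measurable]: "B \<in> sets (hist {0..a})" and D [measurable]: "D \<in> sets borel" by auto
    have "{w. w u \<in> D} \<in> sets (hist {a..})"
      using assms D by (intro coordinate_event_in_hist) auto
    from past_indep_increments[OF assms(1) B this]
    show "emeasure ?P B * emeasure ?I D = emeasure (distr M (hist {0..a} \<Otimes>\<^sub>M borel) (\<lambda>\<omega>. (?X \<omega>, ?i \<omega>))) (B \<times> D)"
      by (subst (1 2 3) emeasure_distr) 
       (auto simp: emeasure_eq_measure vimage_def Int_def conj_ac ennreal_mult[symmetric])
  qed (auto simp: P.sigma_finite_measure_axioms I.sigma_finite_measure_axioms)
  have I: "?I = density lborel (\<lambda>x. ennreal (f (u - a) x))"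
    using increment_density[of a "u - a"] assms by simp
  have "(\<integral>\<^sup>+\<omega>. indicator A (?X \<omega>) * \<phi> (X u \<omega>) \<partial>M)
     = (\<integral>\<^sup>+p. indicator A (fst p) * \<phi> (fst p a + snd p) \<partial>(?P \<Otimes>\<^sub>M ?I))"
    unfolding joint by (subst nn_integral_distr) (auto intro!: nn_integral_cong)
  also have "\<dots> = (\<integral>\<^sup>+w. \<integral>\<^sup>+y. indicator A w * \<phi> (w a + y) \<partial>?I \<partial>?P)"
    by (subst I.nn_integral_fst[symmetric]) auto
  also have "\<dots> = (\<integral>\<^sup>+w. indicator A w * (\<integral>\<^sup>+y. \<phi> (w a + y) \<partial>?I) \<partial>?P)"
    by (intro nn_integral_cong nn_integral_cmult) auto
  also have "\<dots> = (\<integral>\<^sup>+w. indicator A w * (\<integral>\<^sup>+y. ennreal (f (u - a) (y - w a)) * \<phi> y \<partial>lborel) \<partial>?P)"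
  proof (intro nn_integral_cong arg_cong2[where f="(*)"] refl)
    fix w
    have "(\<integral>\<^sup>+y. \<phi> (w a + y) \<partial>?I) = (\<integral>\<^sup>+y. ennreal (f (u - a) y) * \<phi> (w a + y) \<partial>lborel)"
      unfolding I by (subst nn_integral_density) auto
    also have "\<dots> = (\<integral>\<^sup>+y. ennreal (f (u - a) (y - w a)) * \<phi> y \<partial>lborel)"
      by (subst (2) nn_integral_real_affine[where c=1 and t="w a"]) auto
    finally show "(\<integral>\<^sup>+y. \<phi> (w a + y) \<partial>?I) = \<dots>" .
  qed
  also have "\<dots> = (\<integral>\<^sup>+\<omega>. indicator A (?X \<omega>) * (\<integral>\<^sup>+y. ennreal (f (u - a) (y - X a \<omega>)) * \<phi> y \<partial>lborel) \<partial>M)"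
    by (subst nn_integral_distr) auto
  finally show ?thesis .
qed

end

section \<open>Germ events of a Levy process\<close>

context levy_with_density
begin

text \<open>On the past of \<open>a\<close>, restricting the probability to an event of the future increments multiplies it
  by the probability of that event.\<close>

lemma nn_integral_indep_increments:
  assumes "0 \<le> a" "C \<in> sets (hist {a..})" "h \<in> borel_measurable (hist {0..a})"
  shows "(\<integral>\<^sup>+\<omega>. h (\<lambda>q. X q \<omega>) * indicator C (\<lambda>q. X q \<omega> - X a \<omega>) \<partial>M)
    = emeasure M {\<omega>\<in>space M. (\<lambda>q. X q \<omega> - X a \<omega>) \<in> C} * (\<integral>\<^sup>+\<omega>. h (\<lambda>q. X q \<omega>) \<partial>M)"
proof -
  let ?X = "\<lambda>\<omega> q. X q \<omega>"
  let ?C = "{\<omega>\<in>space M. (\<lambda>q. X q \<omega> - X a \<omega>) \<in> C}"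
  have Im: "(\<lambda>\<omega> q. X q \<omega> - X a \<omega>) \<in> measurable M (hist {a..})"
    using assms by (intro increments_measurable) auto
  have [measurable]: "?C \<in> sets M"
    using measurable_sets[OF Im assms(2)] by (simp add: vimage_def Int_def conj_commute)
  have [measurable]: "?X \<in> measurable M (hist {0..a})" by (rule path_measurable) auto
  have eq: "distr (density M (indicator ?C)) (hist {0..a}) ?X
    = scale_measure (emeasure M ?C) (distr M (hist {0..a}) ?X)"
  proof (rule measure_eqI)
    fix B assume "B \<in> sets (distr (density M (indicator ?C)) (hist {0..a}) ?X)"
    then have B [measurable]: "B \<in> sets (hist {0..a})" by simp
    let ?B = "{\<omega>\<in>space M. ?X \<omega> \<in> B}"
    have [measurable]: "?B \<in> sets M"
      using measurable_sets[OF path_measurable B] by (simp add: vimage_def Int_def conj_commute)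
    have "emeasure (distr (density M (indicator ?C)) (hist {0..a}) ?X) B = emeasure (density M (indicator ?C)) ?B"
      by (subst emeasure_distr) (auto intro!: arg_cong2[where f=emeasure])
    also have "\<dots> = (\<integral>\<^sup>+\<omega>. indicator ?C \<omega> * indicator ?B \<omega> \<partial>M)"
      by (rule emeasure_density) auto
    also have "\<dots> = (\<integral>\<^sup>+\<omega>. indicator (?B \<inter> ?C) \<omega> \<partial>M)"
      by (intro nn_integral_cong) (auto split: split_indicator)
    also have "\<dots> = emeasure M (?B \<inter> ?C)"
      by (rule nn_integral_indicator) auto
    also have "\<dots> = emeasure M ?C * emeasure M ?B"
      using past_indep_increments[OF assms(1) B assms(2)] by (simp add: emeasure_eq_measure ennreal_mult mult_ac)
    also have "emeasure M ?B = emeasure (distr M (hist {0..a}) ?X) B"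
      by (subst emeasure_distr) (auto intro!: arg_cong2[where f=emeasure])
    finally show "emeasure (distr (density M (indicator ?C)) (hist {0..a}) ?X) B
      = emeasure (scale_measure (emeasure M ?C) (distr M (hist {0..a}) ?X)) B" by simp
  qed simp
  note assms(3) [measurable]
  have "(\<integral>\<^sup>+\<omega>. h (?X \<omega>) * indicator C (\<lambda>q. X q \<omega> - X a \<omega>) \<partial>M)
      = (\<integral>\<^sup>+\<omega>. indicator ?C \<omega> * h (?X \<omega>) \<partial>M)"
    by (intro nn_integral_cong) (auto simp: indicator_def)
  also have "\<dots> = (\<integral>\<^sup>+w. h w \<partial>distr (density M (indicator ?C)) (hist {0..a}) ?X)"
    by (subst nn_integral_distr) (auto simp: nn_integral_density)
  also have "\<dots> = emeasure M ?C * (\<integral>\<^sup>+\<omega>. h (?X \<omega>) \<partial>M)"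
    unfolding eq by (subst nn_integral_scale_measure) (auto simp: nn_integral_distr)
  finally show ?thesis .
qed

text \<open>Let \<open>h(X)\<close> be a version of the conditional probability of \<open>{X \<in> A}\<close> given the past of \<open>t\<close>. The event
  \<open>A\<close> belongs to the past of every \<open>s n > t\<close>, so it is independent of the increments after \<open>s n\<close>. Hence
  the probability restricted to \<open>{X \<in> A}\<close> and the one weighted by \<open>h(X)\<close> agree on intersections of an
  event of the past of \<open>t\<close> with an event of increments after some \<open>s n\<close>. By right-continuity these
  intersections generate the whole path, so they generate \<open>{X \<in> A}\<close> itself, and \<open>h(X)\<close> is its indicator.\<close>

theorem germ_event_is_past_event:
  assumes "0 \<le> t" and A: "\<And>n. A \<in> sets (hist {0..t + 1 / real (Suc n)})"
  shows "\<exists>B\<in>sets (hist {0..t}). AE \<omega> in M. (\<lambda>q. X q \<omega>) \<in> A \<longleftrightarrow> (\<lambda>q. X q \<omega>) \<in> B"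
proof -
  let ?X = "\<lambda>\<omega> q. X q \<omega>"
  define s where "s n = t + 1 / real (Suc n)" for n
  have s: "t < s n" "0 \<le> s n" for n using assms(1) by (auto simp: s_def intro: add_nonneg_nonneg)
  have s_antimono: "s m \<le> s n" if "n \<le> m" for m n
    using that by (auto simp: s_def intro!: divide_left_mono)
  let ?inc = "\<lambda>n \<omega> q. X q \<omega> - X (s n) \<omega>"
  have Xm: "?X \<in> measurable M (hist J)" if "J \<subseteq> {0..}" for J using that by (rule path_measurable)
  have Xt [measurable]: "?X \<in> measurable M (hist {0..t})" by (rule Xm) auto
  define EA where "EA = {\<omega>\<in>space M. ?X \<omega> \<in> A}"
  have EA_eq: "EA = ?X -` A \<inter> space M" by (auto simp: EA_def)
  have [measurable]: "EA \<in> sets M"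
    unfolding EA_eq by (rule measurable_sets[OF Xm A[of 0]]) auto
  obtain h where h [measurable]: "h \<in> borel_measurable (hist {0..t})"
    and \<eta>: "\<And>B. B \<in> sets (hist {0..t}) \<Longrightarrow>
      (\<integral>\<^sup>+\<omega>. indicator B (?X \<omega>) * indicator EA \<omega> \<partial>M) = (\<integral>\<^sup>+\<omega>. indicator B (?X \<omega>) * h (?X \<omega>) \<partial>M)"
  proof -
    let ?P = "distr M (hist {0..t}) ?X" and ?Q = "distr (density M (indicator EA)) (hist {0..t}) ?X"
    interpret P: prob_space ?P by (rule prob_space_distr) simp
    have Q: "emeasure ?Q B = (\<integral>\<^sup>+\<omega>. indicator B (?X \<omega>) * indicator EA \<omega> \<partial>M)"
      if [measurable]: "B \<in> sets (hist {0..t})" for B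
    proof -
      have "emeasure ?Q B = (\<integral>\<^sup>+w. indicator B w \<partial>?Q)" by simp
      also have "\<dots> = (\<integral>\<^sup>+\<omega>. indicator EA \<omega> * indicator B (?X \<omega>) \<partial>M)"
        by (subst nn_integral_distr) (auto simp: nn_integral_density)
      finally show ?thesis by (simp add: mult.commute)
    qed
    have "absolutely_continuous ?P ?Q"
      unfolding absolutely_continuous_def
    proof
      fix B assume "B \<in> null_sets ?P"
      then have B [measurable]: "B \<in> sets (hist {0..t})" and "emeasure ?P B = 0" by auto
      then have "AE \<omega> in M. ?X \<omega> \<notin> B"
        using AE_distrD[OF Xt, of "\<lambda>w. w \<notin> B"] AE_not_in[OF \<open>B \<in> null_sets ?P\<close>] by simp
      then have "(\<integral>\<^sup>+\<omega>. indicator B (?X \<omega>) * indicator EA \<omega> \<partial>M) = (\<integral>\<^sup>+\<omega>. 0 \<partial>M)"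
        by (intro nn_integral_cong_AE) (auto simp: indicator_def)
      then show "B \<in> null_sets ?Q" using Q[OF B] by (auto simp: null_sets_def)
    qed
    (* The Radon-Nikodym derivative is taken on path space, so that it comes as a function of the path
       that is measurable with respect to the history. *)
    then obtain h where h: "h \<in> borel_measurable ?P" "density ?P h = ?Q"
      using P.Radon_Nikodym[of ?Q] by auto
    show ?thesis
    proof (rule that)
      show hm [measurable]: "h \<in> borel_measurable (hist {0..t})" using h(1) by simp
      fix B assume B [measurable]: "B \<in> sets (hist {0..t})"
      have "emeasure (density ?P h) B = (\<integral>\<^sup>+w. h w * indicator B w \<partial>?P)"
        by (subst emeasure_density) auto
      also have "\<dots> = (\<integral>\<^sup>+\<omega>. h (?X \<omega>) * indicator B (?X \<omega>) \<partial>M)"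
        by (subst nn_integral_distr) auto
      finally show "(\<integral>\<^sup>+\<omega>. indicator B (?X \<omega>) * indicator EA \<omega> \<partial>M) = (\<integral>\<^sup>+\<omega>. indicator B (?X \<omega>) * h (?X \<omega>) \<partial>M)"
        unfolding h(2) Q[OF B] by (simp add: mult.commute)
    qed
  qed
  define \<eta> where "\<eta> \<omega> = h (?X \<omega>)" for \<omega>
  have \<eta>M [measurable]: "\<eta> \<in> borel_measurable M" unfolding \<eta>_def by simp
  have \<eta>_h: "\<eta> \<omega> = h (?X \<omega>)" for \<omega> by (simp add: \<eta>_def)
  (* The generating family. It is closed under intersection because an increment after s n is also
     a difference of increments after s m for m at least n. *)
  define E where "E = (\<Union>n. {{\<omega>\<in>space M. ?X \<omega> \<in> B \<and> ?inc n \<omega> \<in> C} |B C. B \<in> sets (hist {0..t}) \<and> C \<in> sets (hist {s n..})})"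
  have incm: "?inc n \<in> measurable M (hist {s n..})" for n
    using s(2)[of n] by (intro increments_measurable) auto
  have E_sets: "E \<subseteq> sets M"
  proof
    fix D assume "D \<in> E"
    then obtain n B C where D: "D = {\<omega>\<in>space M. ?X \<omega> \<in> B \<and> ?inc n \<omega> \<in> C}"
      and B: "B \<in> sets (hist {0..t})" and C: "C \<in> sets (hist {s n..})" unfolding E_def by auto
    have "D = (?X -` B \<inter> space M) \<inter> (?inc n -` C \<inter> space M)" unfolding D by auto
    then show "D \<in> sets M" using measurable_sets[OF Xt B] measurable_sets[OF incm C] by simp
  qed
  then have E_Pow: "E \<subseteq> Pow (space M)" using sets.sets_into_space by auto
  have E_stable: "Int_stable E"
  proof (rule Int_stableI)
    fix a b assume "a \<in> E" "b \<in> E"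
    then obtain n B C m B' C' where a: "a = {\<omega>\<in>space M. ?X \<omega> \<in> B \<and> ?inc n \<omega> \<in> C}"
        "B \<in> sets (hist {0..t})" "C \<in> sets (hist {s n..})"
      and b: "b = {\<omega>\<in>space M. ?X \<omega> \<in> B' \<and> ?inc m \<omega> \<in> C'}"
        "B' \<in> sets (hist {0..t})" "C' \<in> sets (hist {s m..})" unfolding E_def by auto
    define N where "N = max n m"
    define S where "S k = (\<lambda>w q. w q - w (s k) :: real)" for k
    have S: "S k -` D \<in> sets (hist {s N..})" if "k \<le> N" "D \<in> sets (hist {s k..})" for k D
    proof -
      have "S k \<in> measurable (hist {s N..}) (hist {s k..})"
        unfolding S_def using s_antimono[OF \<open>k \<le> N\<close>]
        by (intro measurable_histI borel_measurable_diff measurable_hist_coordinate) auto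
      from measurable_sets[OF this that(2)] show ?thesis by simp
    qed
    have "a \<inter> b = {\<omega>\<in>space M. ?X \<omega> \<in> B \<inter> B' \<and> ?inc N \<omega> \<in> S n -` C \<inter> S m -` C'}"
      unfolding a b S_def by auto
    moreover have "B \<inter> B' \<in> sets (hist {0..t})" "S n -` C \<inter> S m -` C' \<in> sets (hist {s N..})"
      using a b S[of n C] S[of m C'] by (auto simp: N_def)
    ultimately show "a \<inter> b \<in> E" unfolding E_def by blast
  qed
  let ?\<Sigma> = "sigma (space M) E"
  have sets_\<Sigma>: "sets ?\<Sigma> = sigma_sets (space M) E" by (rule sets_measure_of[OF E_Pow])
  have space_\<Sigma>: "space ?\<Sigma> = space M" by (rule space_measure_of[OF E_Pow])
  have sub\<Sigma>: "sets ?\<Sigma> \<subseteq> sets M"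
    unfolding sets_\<Sigma> by (rule sets.sigma_sets_subset[OF E_sets])
  (* X q for q > t is the sum of X t and the limit of the increments from s n to q. *)
  have EA_\<Sigma>: "EA \<in> sets ?\<Sigma>"
  proof -
    have past: "X q \<in> borel_measurable ?\<Sigma>" if "0 \<le> q" "q \<le> t" for q
    proof (rule measurableI)
      fix D :: "real set" assume "D \<in> sets borel"
      then have "{w. w q \<in> D} \<in> sets (hist {0..t})" using that by (intro coordinate_event_in_hist) auto
      moreover have "X q -` D \<inter> space ?\<Sigma> = {\<omega>\<in>space M. ?X \<omega> \<in> {w. w q \<in> D} \<and> ?inc 0 \<omega> \<in> UNIV}"
        by (auto simp: space_\<Sigma>)
      moreover have "UNIV \<in> sets (hist {s 0..})" using sets.top[of "hist {s 0..}"] by simp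
      ultimately have "X q -` D \<inter> space ?\<Sigma> \<in> E" unfolding E_def by blast
      then show "X q -` D \<inter> space ?\<Sigma> \<in> sets ?\<Sigma>" unfolding sets_\<Sigma> by (rule sigma_sets.Basic)
    qed simp
    have inc: "(\<lambda>\<omega>. X q \<omega> - X (s n) \<omega>) \<in> borel_measurable ?\<Sigma>" if "s n \<le> q" for q n
    proof (rule measurableI)
      fix D :: "real set" assume "D \<in> sets borel"
      then have "{w. w q \<in> D} \<in> sets (hist {s n..})" using that by (intro coordinate_event_in_hist) auto
      moreover have "(\<lambda>\<omega>. X q \<omega> - X (s n) \<omega>) -` D \<inter> space ?\<Sigma> = {\<omega>\<in>space M. ?X \<omega> \<in> UNIV \<and> ?inc n \<omega> \<in> {w. w q \<in> D}}"
        by (auto simp: space_\<Sigma>)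
      moreover have "UNIV \<in> sets (hist {0..t})" using sets.top[of "hist {0..t}"] by simp
      ultimately have "(\<lambda>\<omega>. X q \<omega> - X (s n) \<omega>) -` D \<inter> space ?\<Sigma> \<in> E" unfolding E_def by blast
      then show "(\<lambda>\<omega>. X q \<omega> - X (s n) \<omega>) -` D \<inter> space ?\<Sigma> \<in> sets ?\<Sigma>" unfolding sets_\<Sigma> by (rule sigma_sets.Basic)
    qed simp
    have s_lim: "s \<longlonglongrightarrow> t"
      unfolding s_def using LIMSEQ_inverse_real_of_nat_add[of t] by (simp add: inverse_eq_divide)
    have "X q \<in> borel_measurable ?\<Sigma>" if q: "t < q" for q
    proof -
      obtain n0 where n0: "\<And>n. n0 \<le> n \<Longrightarrow> s n < q"
        using order_tendstoD(2)[OF s_lim q] unfolding eventually_sequentially by blast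
      have "(\<lambda>\<omega>. X q \<omega> - X t \<omega>) \<in> borel_measurable ?\<Sigma>"
      proof (rule borel_measurable_LIMSEQ_real)
        show "(\<lambda>\<omega>. X q \<omega> - X (s (n + n0)) \<omega>) \<in> borel_measurable ?\<Sigma>" for n
          using n0[of "n + n0"] by (intro inc) auto
        fix \<omega> assume "\<omega> \<in> space ?\<Sigma>"
        then have "continuous (at_right t) (\<lambda>t. X t \<omega>)"
          using X_right_continuous assms(1) by (simp add: space_\<Sigma>)
        then have "((\<lambda>t. X t \<omega>) \<longlongrightarrow> X t \<omega>) (at_right t)" by (simp add: continuous_within)
        have "s n \<in> {t<..} \<and> s n \<noteq> t" for n
          using s(1)[of n] by auto
        with s_lim have "filterlim s (at_right t) sequentially"
          by (simp add: filterlim_at)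
        with \<open>((\<lambda>t. X t \<omega>) \<longlongrightarrow> X t \<omega>) (at_right t)\<close>
        have "(\<lambda>n. X (s n) \<omega>) \<longlonglongrightarrow> X t \<omega>" by (rule filterlim_compose)
        then have "(\<lambda>n. X (s (n + n0)) \<omega>) \<longlonglongrightarrow> X t \<omega>" by (rule LIMSEQ_ignore_initial_segment)
        then show "(\<lambda>n. X q \<omega> - X (s (n + n0)) \<omega>) \<longlonglongrightarrow> X q \<omega> - X t \<omega>" by (intro tendsto_intros)
      qed
      then have "(\<lambda>\<omega>. X t \<omega> + (X q \<omega> - X t \<omega>)) \<in> borel_measurable ?\<Sigma>"
        using past[of t] assms(1) by (intro borel_measurable_add) auto
      then show ?thesis by simp
    qed
    then have "?X \<in> measurable ?\<Sigma> (hist {0..s 0})"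
      using past by (intro measurable_histI) (metis atLeastAtMost_iff not_le_imp_less)
    then have "?X -` A \<inter> space ?\<Sigma> \<in> sets ?\<Sigma>" using A[of 0] by (intro measurable_sets) (auto simp: s_def)
    then show ?thesis by (simp add: EA_eq space_\<Sigma>)
  qed
  let ?\<mu>1 = "restr_to_subalg (density M (indicator EA)) ?\<Sigma>" and ?\<mu>2 = "restr_to_subalg (density M \<eta>) ?\<Sigma>"
  have sa: "subalgebra (density M g) ?\<Sigma>" for g
    unfolding subalgebra_def using sub\<Sigma> by (simp add: space_\<Sigma>)
  have "?\<mu>1 = ?\<mu>2"
  proof (rule measure_eqI_generator_eq[OF E_stable E_Pow, where A="\<lambda>_. space M"])
    fix D assume "D \<in> E"
    then obtain n B C where D: "D = {\<omega>\<in>space M. ?X \<omega> \<in> B \<and> ?inc n \<omega> \<in> C}"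
      and B: "B \<in> sets (hist {0..t})" and C: "C \<in> sets (hist {s n..})" unfolding E_def by auto
    have B': "B \<in> sets (hist {0..s n})" and A': "A \<in> sets (hist {0..s n})"
      using B sets_hist_mono[of "{0..t}" "{0..s n}"] s(1)[of n] A[of n] by (auto simp: s_def)
    have hm: "h \<in> borel_measurable (hist {0..s n})"
      using s(1)[of n] h sets_hist_mono[of "{0..t}" "{0..s n}"]
      by (auto simp: measurable_def)
    let ?PC = "emeasure M {\<omega>\<in>space M. ?inc n \<omega> \<in> C}"
    have D_M: "D \<in> sets M" and D_\<Sigma>: "D \<in> sets ?\<Sigma>" using E_sets \<open>D \<in> E\<close> by (auto simp: sets_\<Sigma>)
    have "emeasure ?\<mu>1 D = (\<integral>\<^sup>+\<omega>. indicator EA \<omega> * indicator D \<omega> \<partial>M)"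
      using D_M D_\<Sigma> by (subst emeasure_restr_to_subalg[OF sa]) (auto simp: emeasure_density)
    also have "\<dots> = (\<integral>\<^sup>+\<omega>. indicator (A \<inter> B) (?X \<omega>) * indicator C (?inc n \<omega>) \<partial>M)"
      by (intro nn_integral_cong) (auto simp: D EA_def indicator_def)
    also have "\<dots> = ?PC * (\<integral>\<^sup>+\<omega>. indicator (A \<inter> B) (?X \<omega>) \<partial>M)"
      using A' B' by (intro nn_integral_indep_increments s C) auto
    also have "(\<integral>\<^sup>+\<omega>. indicator (A \<inter> B) (?X \<omega>) \<partial>M) = (\<integral>\<^sup>+\<omega>. indicator B (?X \<omega>) * indicator EA \<omega> \<partial>M)"
      by (intro nn_integral_cong) (auto simp: EA_def indicator_def)
    also have "\<dots> = (\<integral>\<^sup>+\<omega>. indicator B (?X \<omega>) * h (?X \<omega>) \<partial>M)"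
      by (rule \<eta>[OF B])
    also have "?PC * \<dots> = (\<integral>\<^sup>+\<omega>. (indicator B (?X \<omega>) * h (?X \<omega>)) * indicator C (?inc n \<omega>) \<partial>M)"
      using B' hm by (intro nn_integral_indep_increments[symmetric] s C) auto
    also have "\<dots> = (\<integral>\<^sup>+\<omega>. \<eta> \<omega> * indicator D \<omega> \<partial>M)"
      by (intro nn_integral_cong) (auto simp: D \<eta>_h indicator_def)
    also have "\<dots> = emeasure ?\<mu>2 D"
      using D_M D_\<Sigma> by (subst emeasure_restr_to_subalg[OF sa]) (auto simp: emeasure_density)
    finally show "emeasure ?\<mu>1 D = emeasure ?\<mu>2 D" .
  next
    show "range (\<lambda>_::nat. space M) \<subseteq> E"
    proof -
      have "space M = {\<omega>\<in>space M. ?X \<omega> \<in> UNIV \<and> ?inc 0 \<omega> \<in> UNIV}" by auto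
      moreover have "UNIV \<in> sets (hist {0..t})" "UNIV \<in> sets (hist {s 0..})"
        using sets.top[of "hist {0..t}"] sets.top[of "hist {s 0..}"] by auto
      ultimately show ?thesis unfolding E_def by blast
    qed
    have "emeasure ?\<mu>1 (space M) = emeasure (density M (indicator EA)) (space M)"
      using sets.top[of ?\<Sigma>] unfolding space_\<Sigma> by (rule emeasure_restr_to_subalg[OF sa])
    also have "\<dots> = (\<integral>\<^sup>+\<omega>. indicator EA \<omega> * indicator (space M) \<omega> \<partial>M)"
      by (rule emeasure_density) auto
    also have "\<dots> = (\<integral>\<^sup>+\<omega>. indicator EA \<omega> \<partial>M)"
      by (rule nn_integral_cong) simp
    also have "\<dots> = emeasure M EA" by simp
    also have "\<dots> \<noteq> \<infinity>" by (simp add: emeasure_eq_measure)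
    finally show "emeasure ?\<mu>1 (space M) \<noteq> \<infinity>" for i :: nat .
  qed (auto simp: sets_\<Sigma> sets_restr_to_subalg[OF sa])
  moreover have "space M - EA \<in> sets ?\<Sigma>" using sets.compl_sets[OF EA_\<Sigma>] by (simp add: space_\<Sigma>)
  ultimately have "emeasure (density M (indicator EA)) (space M - EA) = emeasure (density M \<eta>) (space M - EA)"
    by (metis emeasure_restr_to_subalg sa)
  then have "(\<integral>\<^sup>+\<omega>. \<eta> \<omega> * indicator (space M - EA) \<omega> \<partial>M) = (\<integral>\<^sup>+\<omega>. indicator EA \<omega> * indicator (space M - EA) \<omega> \<partial>M)"
    by (simp add: emeasure_density)
  also have "\<dots> = (\<integral>\<^sup>+\<omega>. 0 \<partial>M)" by (intro nn_integral_cong) (auto simp: indicator_def)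
  finally have "AE \<omega> in M. \<eta> \<omega> * indicator (space M - EA) \<omega> = 0"
    by (simp add: nn_integral_0_iff_AE)
  then have 1: "AE \<omega> in M. \<omega> \<notin> EA \<longrightarrow> \<eta> \<omega> = 0"
    using AE_space by eventually_elim (auto simp: indicator_def split: if_splits)
  have Z: "{w. h w = 0} \<in> sets (hist {0..t})"
  proof -
    have "{w\<in>space (hist {0..t}). h w = 0} \<in> sets (hist {0..t})" by measurable
    then show ?thesis by simp
  qed
  have "(\<integral>\<^sup>+\<omega>. indicator {w. h w = 0} (?X \<omega>) * indicator EA \<omega> \<partial>M) = (\<integral>\<^sup>+\<omega>. indicator {w. h w = 0} (?X \<omega>) * h (?X \<omega>) \<partial>M)"
    by (rule \<eta>[OF Z])
  also have "\<dots> = (\<integral>\<^sup>+\<omega>. 0 \<partial>M)" by (intro nn_integral_cong) (auto simp: indicator_def)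
  finally have "AE \<omega> in M. indicator {w. h w = 0} (?X \<omega>) * indicator EA \<omega> = (0::ennreal)"
    using Z by (simp add: nn_integral_0_iff_AE)
  then have 2: "AE \<omega> in M. \<omega> \<in> EA \<longrightarrow> \<eta> \<omega> \<noteq> 0"
    using AE_space by eventually_elim (auto simp: \<eta>_h indicator_def split: if_splits)
  (* Facts 1 and 2 say that h(X) vanishes almost surely exactly off EA, which identifies EA
     up to a null set. *)
  have "AE \<omega> in M. ?X \<omega> \<in> A \<longleftrightarrow> ?X \<omega> \<in> {w. h w \<noteq> 0}"
    using 1 2 AE_space by eventually_elim (auto simp: EA_def \<eta>_h)
  moreover have "{w. h w \<noteq> 0} \<in> sets (hist {0..t})"
    using sets.compl_sets[OF Z] by (simp add: Collect_neg_eq Compl_eq_Diff_UNIV)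
  ultimately show ?thesis by blast
qed

end

section \<open>The law of a bridge of deterministic length\<close>

lemma prod_indicator_eq_indicator_PiE:
  assumes "finite I" "x \<in> extensional I"
  shows "(\<Prod>i\<in>I. indicator (A i) (x i)) = (indicator (PiE I A) x :: ennreal)"
proof (cases "x \<in> PiE I A")
  case True
  then show ?thesis by (auto simp: PiE_iff intro!: prod.neutral)
next
  case False
  then obtain i where "i \<in> I" "x i \<notin> A i" using assms by (auto simp: PiE_iff)
  then have "(\<Prod>i\<in>I. indicator (A i) (x i) :: ennreal) = 0"
    using assms by (intro prod_zero bexI[of _ i]) auto
  then show ?thesis using False by simp
qed

context levy_with_density
begin

text \<open>Induction on the number of times: the last coordinate is integrated out by the transition density, and
  the result is absorbed into the test function \<open>\<phi>\<close> of the last value, which is why \<open>\<phi>\<close> is arbitrary. The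
  update \<open>x(0 := 0)\<close> is the convention \<open>x\<^sub>0 = 0\<close> of the bridge densities.\<close>

lemma finite_dimensional_law:
  fixes t :: "nat \<Rightarrow> real"
  assumes "t 0 = 0" "\<And>i. i < n \<Longrightarrow> t i < t (Suc i)"
    and A [measurable]: "\<And>i. A i \<in> sets borel" and "\<phi> \<in> borel_measurable borel"
  shows "(\<integral>\<^sup>+\<omega>. indicator {w. \<forall>i\<le>n. w (t i) \<in> A i} (\<lambda>q. X q \<omega>) * \<phi> (X (t n) \<omega>) \<partial>M)
    = indicator (A 0) 0 * (\<integral>\<^sup>+x. (\<Prod>i=1..n. ennreal (f (t i - t (i - 1)) ((x(0 := 0)) i - (x(0 := 0)) (i - 1))) *
        indicator (A i) (x i)) * \<phi> ((x(0 := 0)) n) \<partial>PiM {1..n} (\<lambda>_. lborel))"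
  using assms(2,4)
proof (induction n arbitrary: \<phi>)
  case 0
  interpret product_sigma_finite "\<lambda>_::nat. lborel :: real measure" ..
  have "(\<integral>\<^sup>+\<omega>. indicator {w. \<forall>i\<le>0. w (t i) \<in> A i} (\<lambda>q. X q \<omega>) * \<phi> (X (t 0) \<omega>) \<partial>M)
      = (\<integral>\<^sup>+\<omega>. indicator (A 0) 0 * \<phi> 0 \<partial>M)"
    by (intro nn_integral_cong) (auto simp: assms(1) X_0 indicator_def)
  also have "\<dots> = indicator (A 0) 0 * \<phi> 0" by (simp add: emeasure_space_1)
  finally show ?case by (simp add: space_PiM_empty)
next
  case (Suc n)
  interpret product_sigma_finite "\<lambda>_::nat. lborel :: real measure" ..
  note Suc.prems(2) [measurable]
  have t_mono: "t i \<le> t j" if "i \<le> j" "j \<le> Suc n" for i j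
    using that
  proof (induction j rule: dec_induct)
    case (step m)
    then show ?case using Suc.prems(1)[of m] by auto
  qed simp
  have tn: "0 \<le> t n" "t n < t (Suc n)" using t_mono[of 0 n] Suc.prems(1)[of n] assms(1) by auto
  define \<phi>1 where "\<phi>1 y = indicator (A (Suc n)) y * \<phi> y" for y
  define \<phi>2 where "\<phi>2 x = (\<integral>\<^sup>+y. ennreal (f (t (Suc n) - t n) (y - x)) * \<phi>1 y \<partial>lborel)" for x
  have [measurable]: "\<phi>1 \<in> borel_measurable borel" unfolding \<phi>1_def by measurable
  have [measurable]: "\<phi>2 \<in> borel_measurable borel" unfolding \<phi>2_def by measurable
  have coord [measurable]: "(\<lambda>x. (x(0 := 0)) i) \<in> borel_measurable (PiM {1..n} (\<lambda>_. lborel))" if "i \<le> n" for i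
    using that by (cases "i = 0") (auto intro!: measurable_component_singleton)
  let ?P = "\<lambda>x i. ennreal (f (t i - t (i - 1)) ((x(0 := 0)) i - (x(0 := 0)) (i - 1))) * indicator (A i) (x i)"
  have P_meas: "(\<lambda>x. \<Prod>i=1..n. ?P x i) \<in> borel_measurable (PiM {1..n} (\<lambda>_. lborel))"
  proof (rule borel_measurable_prod_ennreal)
    fix i assume i: "i \<in> {1..n}"
    have [measurable]: "(\<lambda>x. x i) \<in> borel_measurable (PiM {1..n} (\<lambda>_. lborel))"
      using measurable_component_singleton[OF i, of "\<lambda>_. lborel"] by simp
    have "i \<le> n" "i - 1 \<le> n" using i by auto
    note this[THEN coord, measurable]
    show "(\<lambda>x. ?P x i) \<in> borel_measurable (PiM {1..n} (\<lambda>_. lborel))" by measurable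
  qed
  have cyl: "{w. \<forall>i\<le>n. w (t i) \<in> A i} \<in> sets (hist {0..t n})"
  proof -
    have "{w\<in>space (hist {0..t n}). \<forall>i\<in>{..n}. w (t i) \<in> A i} \<in> sets (hist {0..t n})"
    proof (intro sets.sets_Collect_finite_All)
      fix i assume "i \<in> {..n}"
      then have "{w. w (t i) \<in> A i} \<in> sets (hist {0..t n})"
        using t_mono[of 0 i] t_mono[of i n] assms(1) A by (intro coordinate_event_in_hist) auto
      then show "{w \<in> space (hist {0..t n}). w (t i) \<in> A i} \<in> sets (hist {0..t n})" by simp
    qed simp
    then show ?thesis by (simp add: Ball_def)
  qed
  have "(\<integral>\<^sup>+\<omega>. indicator {w. \<forall>i\<le>Suc n. w (t i) \<in> A i} (\<lambda>q. X q \<omega>) * \<phi> (X (t (Suc n)) \<omega>) \<partial>M)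
     = (\<integral>\<^sup>+\<omega>. indicator {w. \<forall>i\<le>n. w (t i) \<in> A i} (\<lambda>q. X q \<omega>) * \<phi>1 (X (t (Suc n)) \<omega>) \<partial>M)"
    by (intro nn_integral_cong) (auto simp: \<phi>1_def indicator_def le_Suc_eq)
  also have "\<dots> = (\<integral>\<^sup>+\<omega>. indicator {w. \<forall>i\<le>n. w (t i) \<in> A i} (\<lambda>q. X q \<omega>) * \<phi>2 (X (t n) \<omega>) \<partial>M)"
    unfolding \<phi>2_def by (intro expectation_given_past tn cyl) simp
  also have "\<dots> = indicator (A 0) 0 * (\<integral>\<^sup>+x. (\<Prod>i=1..n. ?P x i) * \<phi>2 ((x(0 := 0)) n) \<partial>PiM {1..n} (\<lambda>_. lborel))"
    using Suc.prems(1) by (intro Suc.IH) auto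
  also have "(\<integral>\<^sup>+x. (\<Prod>i=1..n. ?P x i) * \<phi>2 ((x(0 := 0)) n) \<partial>PiM {1..n} (\<lambda>_. lborel))
    = (\<integral>\<^sup>+x. (\<integral>\<^sup>+y. (\<Prod>i=1..Suc n. ?P (x(Suc n := y)) i) * \<phi> (((x(Suc n := y))(0 := 0)) (Suc n)) \<partial>lborel) \<partial>PiM {1..n} (\<lambda>_. lborel))"
  proof (rule nn_integral_cong)
    fix x :: "nat \<Rightarrow> real"
    have "(\<Prod>i=1..Suc n. ?P (x(Suc n := y)) i) * \<phi> (((x(Suc n := y))(0 := 0)) (Suc n))
      = (\<Prod>i=1..n. ?P x i) * (ennreal (f (t (Suc n) - t n) (y - (x(0 := 0)) n)) * \<phi>1 y)" for y
    proof -
      have "(\<Prod>i=1..n. ?P (x(Suc n := y)) i) = (\<Prod>i=1..n. ?P x i)"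
        by (intro prod.cong) auto
      moreover have "(\<Prod>i=1..Suc n. ?P (x(Suc n := y)) i) = (\<Prod>i=1..n. ?P (x(Suc n := y)) i) * ?P (x(Suc n := y)) (Suc n)"
        by (subst prod.cl_ivl_Suc) simp
      moreover have "?P (x(Suc n := y)) (Suc n) * \<phi> (((x(Suc n := y))(0 := 0)) (Suc n))
          = ennreal (f (t (Suc n) - t n) (y - (x(0 := 0)) n)) * \<phi>1 y"
        by (simp add: \<phi>1_def mult_ac)
      ultimately show ?thesis by (simp only: mult.assoc)
    qed
    then show "(\<Prod>i=1..n. ?P x i) * \<phi>2 ((x(0 := 0)) n)
      = (\<integral>\<^sup>+y. (\<Prod>i=1..Suc n. ?P (x(Suc n := y)) i) * \<phi> (((x(Suc n := y))(0 := 0)) (Suc n)) \<partial>lborel)"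
      unfolding \<phi>2_def by (simp add: nn_integral_cmult)
  qed
  also have "\<dots> = (\<integral>\<^sup>+x. (\<Prod>i=1..Suc n. ?P x i) * \<phi> ((x(0 := 0)) (Suc n)) \<partial>PiM (insert (Suc n) {1..n}) (\<lambda>_. lborel))"
  proof (rule product_nn_integral_insert[symmetric])
    have eq: "insert (Suc n) {1..n} = {1..Suc n}" by auto
    have c: "(\<lambda>x. (x(0 := 0)) i) \<in> borel_measurable (PiM {1..Suc n} (\<lambda>_. lborel))" if "i \<le> Suc n" for i
      using that by (cases "i = 0") (auto intro!: measurable_component_singleton)
    note c[OF order_refl, measurable]
    have "(\<lambda>x. \<Prod>i=1..Suc n. ?P x i) \<in> borel_measurable (PiM {1..Suc n} (\<lambda>_. lborel))"
    proof (rule borel_measurable_prod_ennreal)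
      fix i assume i: "i \<in> {1..Suc n}"
      have [measurable]: "(\<lambda>x. x i) \<in> borel_measurable (PiM {1..Suc n} (\<lambda>_. lborel))"
        using measurable_component_singleton[OF i, of "\<lambda>_. lborel"] by simp
      have "i \<le> Suc n" "i - 1 \<le> Suc n" using i by auto
      note this[THEN c, measurable]
      show "(\<lambda>x. ?P x i) \<in> borel_measurable (PiM {1..Suc n} (\<lambda>_. lborel))" by measurable
    qed
    then show "(\<lambda>x. (\<Prod>i=1..Suc n. ?P x i) * \<phi> ((x(0 := 0)) (Suc n))) \<in> borel_measurable (PiM (insert (Suc n) {1..n}) (\<lambda>_. lborel))"
      unfolding eq by measurable
  qed auto
  also have "insert (Suc n) {1..n} = {1..Suc n}" by auto
  finally show ?case .
qed

text \<open>The density of the bridge is the density of \<open>X\<close> at the same times multiplied by a function of the last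
  value. For \<open>n = 0\<close> only time \<open>0\<close> is involved, where both processes start at \<open>0\<close> and the weight is \<open>1\<close>.\<close>

lemma bridge_finite_dimensional_law:
  fixes t :: "nat \<Rightarrow> real"
  assumes bridge: "levy_bridge \<psi> r z N Y"
    and t: "t 0 = 0" "\<And>i. i < n \<Longrightarrow> t i < t (Suc i)" "t n < r"
    and A [measurable]: "\<And>i. A i \<in> sets borel"
  shows "emeasure N {\<omega>\<in>space N. \<forall>i\<le>n. Y (t i) \<omega> \<in> A i}
    = (\<integral>\<^sup>+\<omega>. indicator {w. \<forall>i\<le>n. w (t i) \<in> A i} (\<lambda>q. X q \<omega>) * ennreal (f (r - t n) (z - X (t n) \<omega>) / f r z) \<partial>M)"
proof -
  interpret N: prob_space N using bridge by (simp add: levy_bridge_def)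
  have fr: "0 < f r z" and Y0: "AE \<omega> in N. Y 0 \<omega> = 0" 
    and Ym: "\<And>q. 0 \<le> q \<Longrightarrow> Y q \<in> borel_measurable N"
    using bridge by (auto simp: levy_bridge_def cadlag_process_def)
  define \<phi> where "\<phi> x = ennreal (f (r - t n) (z - x) / f r z)" for x
  have [measurable]: "\<phi> \<in> borel_measurable borel" unfolding \<phi>_def by measurable
  have X_side: "(\<integral>\<^sup>+\<omega>. indicator {w. \<forall>i\<le>n. w (t i) \<in> A i} (\<lambda>q. X q \<omega>) * \<phi> (X (t n) \<omega>) \<partial>M)
    = indicator (A 0) 0 * (\<integral>\<^sup>+x. (\<Prod>i=1..n. ennreal (f (t i - t (i - 1)) ((x(0 := 0)) i - (x(0 := 0)) (i - 1))) *
        indicator (A i) (x i)) * \<phi> ((x(0 := 0)) n) \<partial>PiM {1..n} (\<lambda>_. lborel))"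
    using t by (intro finite_dimensional_law) auto
  have "emeasure N {\<omega>\<in>space N. \<forall>i\<le>n. Y (t i) \<omega> \<in> A i} = \<dots>"
  proof (cases n)
    case 0
    interpret product_sigma_finite "\<lambda>_::nat. lborel :: real measure" ..
    have "emeasure N {\<omega>\<in>space N. \<forall>i\<le>n. Y (t i) \<omega> \<in> A i} = emeasure N {\<omega>\<in>space N. 0 \<in> A 0}"
    proof (rule emeasure_eq_AE)
      show "AE \<omega> in N. \<omega> \<in> {\<omega>\<in>space N. \<forall>i\<le>n. Y (t i) \<omega> \<in> A i} \<longleftrightarrow> \<omega> \<in> {\<omega>\<in>space N. 0 \<in> A 0}"
        using Y0 by eventually_elim (simp add: 0 t(1))
      show "{\<omega>\<in>space N. \<forall>i\<le>n. Y (t i) \<omega> \<in> A i} \<in> sets N"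
        using measurable_event[OF Ym[of 0] A[of 0]] by (simp add: 0 t(1))
    qed auto
    also have "\<dots> = indicator (A 0) 0" by (auto simp: N.emeasure_space_1 indicator_def)
    finally show ?thesis using fr by (simp add: 0 t(1) \<phi>_def space_PiM_empty)
  next
    case (Suc m)
    then have n: "1 \<le> n" by simp
    let ?Z = "\<lambda>\<omega>. \<lambda>i\<in>{1..n}. Y (t i) \<omega>" and ?L = "PiM {1..n} (\<lambda>_. lborel :: real measure)"
    have dist: "distributed N ?L ?Z (\<lambda>x. ennreal (bridge_density \<psi> r z n t x))"
      using bridge n t unfolding levy_bridge_def by blast
    have box: "PiE {1..n} A \<in> sets ?L" by (intro sets_PiM_I_finite) auto
    have t_pos: "0 \<le> t i" if "i \<le> n" for i
      using that
    proof (induction i)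
      case (Suc i)
      then show ?case using t(2)[of i] by auto
    qed (simp add: t)
    have "emeasure N {\<omega>\<in>space N. \<forall>i\<le>n. Y (t i) \<omega> \<in> A i}
      = indicator (A 0) 0 * emeasure N (?Z -` PiE {1..n} A \<inter> space N)"
    proof (cases "0 \<in> A 0")
      case True
      have "emeasure N {\<omega>\<in>space N. \<forall>i\<le>n. Y (t i) \<omega> \<in> A i} = emeasure N (?Z -` PiE {1..n} A \<inter> space N)"
      proof (rule emeasure_eq_AE)
        show "AE \<omega> in N. \<omega> \<in> {\<omega>\<in>space N. \<forall>i\<le>n. Y (t i) \<omega> \<in> A i} \<longleftrightarrow> \<omega> \<in> ?Z -` PiE {1..n} A \<inter> space N"
          using Y0
        proof eventually_elim
          case (elim \<omega>)
          have "(\<forall>i\<le>n. Y (t i) \<omega> \<in> A i) \<longleftrightarrow> (\<forall>i\<in>{1..n}. Y (t i) \<omega> \<in> A i)"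
          proof (intro iffI allI impI ballI)
            fix i assume R: "\<forall>i\<in>{1..n}. Y (t i) \<omega> \<in> A i" and "i \<le> n"
            show "Y (t i) \<omega> \<in> A i"
            proof (cases "i = 0")
              case False
              with \<open>i \<le> n\<close> have "i \<in> {1..n}" by simp
              then show ?thesis using R by blast
            qed (simp add: elim True t(1))
          qed simp
          then show ?case by (simp add: PiE_iff) blast
        qed
        have "{\<omega>\<in>space N. \<forall>i\<in>{..n}. Y (t i) \<omega> \<in> A i} \<in> sets N"
        proof (intro sets.sets_Collect_finite_All)
          fix i assume "i \<in> {..n}"
          then show "{\<omega>\<in>space N. Y (t i) \<omega> \<in> A i} \<in> sets N"
            using t_pos[of i] by (intro measurable_event[OF Ym A]) simp
        qed simp
        then show "{\<omega>\<in>space N. \<forall>i\<le>n. Y (t i) \<omega> \<in> A i} \<in> sets N" unfolding Ball_def atMost_iff .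
        show "?Z -` PiE {1..n} A \<inter> space N \<in> sets N"
          using distributed_measurable[OF dist] box by (rule measurable_sets)
      qed
      then show ?thesis using True by simp
    next
      case False
      have "emeasure N {\<omega>\<in>space N. \<forall>i\<le>n. Y (t i) \<omega> \<in> A i} = 0"
      proof (rule emeasure_eq_0_AE)
        show "AE \<omega> in N. \<not> (\<forall>i\<le>n. Y (t i) \<omega> \<in> A i)"
          using Y0 by eventually_elim (use False t(1) in auto)
      qed
      then show ?thesis using False by simp
    qed
    also have "emeasure N (?Z -` PiE {1..n} A \<inter> space N)
      = (\<integral>\<^sup>+x. ennreal (bridge_density \<psi> r z n t x) * indicator (PiE {1..n} A) x \<partial>?L)"
      by (rule distributed_emeasure[OF dist box])
    also have "\<dots> = (\<integral>\<^sup>+x. (\<Prod>i=1..n. ennreal (f (t i - t (i - 1)) ((x(0 := 0)) i - (x(0 := 0)) (i - 1))) *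
        indicator (A i) (x i)) * \<phi> ((x(0 := 0)) n) \<partial>?L)"
    proof (rule nn_integral_cong)
      fix x assume "x \<in> space ?L"
      then have ext: "x \<in> extensional {1..n}" by (simp add: space_PiM PiE_iff)
      let ?p = "\<lambda>i. f (t i - t (i - 1)) ((x(0 := 0)) i - (x(0 := 0)) (i - 1))"
      have pos: "0 \<le> ?p i" if "i \<in> {1..n}" for i
      proof (rule density_nonneg)
        have "i - 1 < n" "Suc (i - 1) = i" using that by auto
        then show "0 < t i - t (i - 1)" using t(2)[of "i - 1"] by simp
      qed
      have bd: "bridge_density \<psi> r z n t x = f (r - t n) (z - (x(0 := 0)) n) / f r z * (\<Prod>i=1..n. ?p i)"
        by (simp only: bridge_density_def Let_def)
      have "0 \<le> f (r - t n) (z - (x(0 := 0)) n) / f r z"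
        using fr t(3) by (intro divide_nonneg_pos density_nonneg) auto
      moreover have "0 \<le> (\<Prod>i=1..n. ?p i)" by (rule prod_nonneg) (rule pos)
      moreover have "(\<Prod>i=1..n. ennreal (?p i)) = ennreal (\<Prod>i=1..n. ?p i)"
        by (rule prod_ennreal) (rule pos)
      ultimately have "ennreal (bridge_density \<psi> r z n t x) = \<phi> ((x(0 := 0)) n) * (\<Prod>i=1..n. ennreal (?p i))"
        unfolding bd \<phi>_def by (simp only: ennreal_mult)
      then show "ennreal (bridge_density \<psi> r z n t x) * indicator (PiE {1..n} A) x
        = (\<Prod>i=1..n. ennreal (?p i) * indicator (A i) (x i)) * \<phi> ((x(0 := 0)) n)"
        unfolding prod.distrib prod_indicator_eq_indicator_PiE[OF finite_atLeastAtMost ext]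
        by (simp only: mult_ac)
    qed
    finally show ?thesis .
  qed
  then show ?thesis using X_side by (simp only: \<phi>_def)
qed

text \<open>Up to a time \<open>s < r\<close>, the bridge is the h-transform of the Levy process: both sides are finite measures
  on the history of \<open>s\<close> which agree on cylinders. The times of a cylinder are completed by \<open>0\<close> and \<open>s\<close>, so
  that the weight sits at \<open>s\<close>.\<close>

theorem bridge_law:
  assumes bridge: "levy_bridge \<psi> r z N Y" and "0 \<le> s" "s < r" and B: "B \<in> sets (hist {0..s})"
  shows "emeasure N {\<omega>\<in>space N. (\<lambda>q. Y q \<omega>) \<in> B}
    = (\<integral>\<^sup>+\<omega>. indicator B (\<lambda>q. X q \<omega>) * ennreal (f (r - s) (z - X s \<omega>) / f r z) \<partial>M)"
proof -
  interpret N: prob_space N using bridge by (simp add: levy_bridge_def)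
  have Ym: "\<And>q. 0 \<le> q \<Longrightarrow> Y q \<in> borel_measurable N"
    using bridge by (auto simp: levy_bridge_def cadlag_process_def)
  have Y [measurable]: "(\<lambda>\<omega> q. Y q \<omega>) \<in> measurable N (hist {0..s})"
    by (rule measurable_histI) (auto intro: Ym)
  have Xm [measurable]: "(\<lambda>\<omega> q. X q \<omega>) \<in> measurable M (hist {0..s})" by (rule path_measurable) auto
  have [measurable]: "X s \<in> borel_measurable M" using assms(2) by (rule X_measurable)
  define \<rho> where "\<rho> \<omega> = ennreal (f (r - s) (z - X s \<omega>) / f r z)" for \<omega>
  have [measurable]: "\<rho> \<in> borel_measurable M" unfolding \<rho>_def by measurable
  let ?\<mu> = "distr N (hist {0..s}) (\<lambda>\<omega> q. Y q \<omega>)" and ?\<nu> = "distr (density M \<rho>) (hist {0..s}) (\<lambda>\<omega> q. X q \<omega>)"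
  have \<mu>: "emeasure ?\<mu> B = emeasure N {\<omega>\<in>space N. (\<lambda>q. Y q \<omega>) \<in> B}" if "B \<in> sets (hist {0..s})" for B
    using that by (subst emeasure_distr) (auto simp: vimage_def Int_def conj_commute)
  have \<nu>: "emeasure ?\<nu> B = (\<integral>\<^sup>+\<omega>. indicator B (\<lambda>q. X q \<omega>) * \<rho> \<omega> \<partial>M)" if [measurable]: "B \<in> sets (hist {0..s})" for B
  proof -
    have "emeasure ?\<nu> B = (\<integral>\<^sup>+w. indicator B w \<partial>?\<nu>)" by simp
    also have "\<dots> = (\<integral>\<^sup>+\<omega>. \<rho> \<omega> * indicator B (\<lambda>q. X q \<omega>) \<partial>M)"
      by (subst nn_integral_distr) (auto simp: nn_integral_density)
    finally show ?thesis by (simp add: mult.commute)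
  qed
  have "?\<mu> = ?\<nu>"
  proof (rule hist_measure_eqI)
    show "emeasure ?\<mu> UNIV \<noteq> \<infinity>"
      using sets.top[of "hist {0..s}"] by (subst \<mu>) (auto simp: N.emeasure_eq_measure)
    fix F and A :: "real \<Rightarrow> real set" assume F: "finite F" "F \<subseteq> {0..s}" and A: "\<And>q. A q \<in> sets borel"
    have "finite (F \<union> {0, s})" "0 \<in> F \<union> {0, s}" "F \<union> {0, s} \<subseteq> {0..}"
      using F assms(2) by auto
    from ex_increasing_enumeration[OF this] obtain n :: nat and t
      where "t 0 = 0 \<and> (\<forall>i j. i < j \<longrightarrow> j \<le> n \<longrightarrow> t i < t j) \<and> t ` {..n} = F \<union> {0, s}"
      by blast
    then have t: "t 0 = 0" "\<And>i j. i < j \<Longrightarrow> j \<le> n \<Longrightarrow> t i < t j" "t ` {..n} = F \<union> {0, s}"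
      by simp_all
    have tn: "t n = s"
    proof (rule antisym)
      have "t n \<in> F \<union> {0, s}" unfolding t(3)[symmetric] by auto
      then show "t n \<le> s" using F(2) assms(2) by auto
      obtain k where "k \<le> n" "t k = s" using t(3) by (metis UnI2 atMost_iff imageE insert_iff)
      then show "s \<le> t n" using t(2)[of k n] by (cases "k = n") auto
    qed
    define A' where "A' i = (if t i \<in> F then A (t i) else UNIV)" for i
    have FA: "(\<forall>q\<in>F. w q \<in> A q) \<longleftrightarrow> (\<forall>i\<le>n. w (t i) \<in> A' i)" for w
    proof
      assume R: "\<forall>i\<le>n. w (t i) \<in> A' i"
      show "\<forall>q\<in>F. w q \<in> A q"
      proof
        fix q assume "q \<in> F"
        then obtain i where "i \<le> n" "t i = q" using t(3) by (metis UnI1 atMost_iff imageE)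
        then show "w q \<in> A q" using R \<open>q \<in> F\<close> unfolding A'_def by fastforce
      qed
    qed (auto simp: A'_def)
    have C: "{w. \<forall>q\<in>F. w q \<in> A q} \<in> sets (hist {0..s})"
      using cylinders_subset_hist[of "{0..s}"] F A unfolding cylinders_def by blast
    have "emeasure N {\<omega>\<in>space N. \<forall>i\<le>n. Y (t i) \<omega> \<in> A' i}
      = (\<integral>\<^sup>+\<omega>. indicator {w. \<forall>i\<le>n. w (t i) \<in> A' i} (\<lambda>q. X q \<omega>) * ennreal (f (r - t n) (z - X (t n) \<omega>) / f r z) \<partial>M)"
      using t tn assms(3) A by (intro bridge_finite_dimensional_law[OF bridge]) (auto simp: A'_def)
    then show "emeasure ?\<mu> {w. \<forall>q\<in>F. w q \<in> A q} = emeasure ?\<nu> {w. \<forall>q\<in>F. w q \<in> A q}"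
      unfolding \<mu>[OF C] \<nu>[OF C] by (simp add: FA tn \<rho>_def)
  qed simp_all
  then show ?thesis using \<mu>[OF B] \<nu>[OF B] by (simp add: \<rho>_def)
qed

end

section \<open>Regular versions of Levy processes\<close>

text \<open>Independence only depends on the joint law.\<close>

lemma (in prob_space) indep_vars_cong_AE:
  assumes "indep_vars N Y I" "finite I"
    and "\<And>i. i \<in> I \<Longrightarrow> AE \<omega> in M. Y i \<omega> = Z i \<omega>" "\<And>i. i \<in> I \<Longrightarrow> Z i \<in> measurable M (N i)"
  shows "indep_vars N Z I"
proof (cases "I = {}")
  case True
  then show ?thesis by (simp add: indep_vars_def indep_sets_def)
next
  case False
  have Y: "\<And>i. i \<in> I \<Longrightarrow> Y i \<in> measurable M (N i)" using assms(1) by (simp add: indep_vars_def)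
  have "AE \<omega> in M. \<forall>i\<in>I. Y i \<omega> = Z i \<omega>"
    using assms(2,3) by (intro AE_finite_allI) auto
  then have "AE \<omega> in M. (\<lambda>i\<in>I. Z i \<omega>) = (\<lambda>i\<in>I. Y i \<omega>)"
    by eventually_elim (auto simp: restrict_def)
  then have "distr M (PiM I N) (\<lambda>\<omega>. \<lambda>i\<in>I. Z i \<omega>) = distr M (PiM I N) (\<lambda>\<omega>. \<lambda>i\<in>I. Y i \<omega>)"
    by (intro distr_cong_AE) (auto intro!: measurable_restrict Y assms(4))
  also have "\<dots> = PiM I (\<lambda>i. distr M (N i) (Y i))"
    using assms(1) by (subst (asm) indep_vars_iff_distr_eq_PiM'[OF False Y]) auto
  also have "\<dots> = PiM I (\<lambda>i. distr M (N i) (Z i))"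
    by (intro PiM_cong refl distr_cong_AE assms(3,4) Y)
  finally show ?thesis
    using indep_vars_iff_distr_eq_PiM'[OF False assms(4)] by simp
qed

text \<open>The two integrands have conjugate exponentials and a real factor, so their real parts coincide.\<close>

lemma inversion_density_eq_levy_density:
  assumes "real_distribution N" "\<And>u. char N u = complex_of_real (exp (s * \<psi> u))"
    and int: "integrable lborel (\<lambda>u. exp (s * \<psi> u))"
  shows "real_distribution.inversion_density N x = levy_density \<psi> s x"
proof -
  interpret real_distribution N by fact
  have cint: "complex_integrable lborel (\<lambda>t. iexp (c * t) * complex_of_real (exp (s * \<psi> t)))" for c
    by (rule Bochner_Integration.integrable_bound[OF int])
      (use borel_measurable_integrable[OF int] in \<open>auto simp: norm_mult\<close>)
  have "Re (CLBINT t. iexp (- (t * x)) * char N t) = Re (CLBINT t. iexp ((- x) * t) * complex_of_real (exp (s * \<psi> t)))"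
    by (simp add: assms(2) mult.commute)
  also have "\<dots> = (LBINT t. Re (iexp ((- x) * t) * complex_of_real (exp (s * \<psi> t))))"
    by (rule integral_Re[symmetric, OF cint])
  also have "\<dots> = (LBINT t. Re (iexp (x * t) * complex_of_real (exp (s * \<psi> t))))"
    by (simp add: Re_exp)
  also have "\<dots> = Re (CLBINT t. iexp (x * t) * complex_of_real (exp (s * \<psi> t)))"
    by (rule integral_Re[OF cint])
  finally show ?thesis by (simp only: inversion_density_def levy_density_def)
qed

text \<open>Setting the process to \<open>0\<close> on a null set that contains the bad paths changes no joint law at finitely
  many times; the densities of the increments come from stationarity and inversion.\<close>

lemma levy_process_has_regular_version:
  assumes levy: "levy_process M X" and ce: "char_exponent M X \<psi>"
    and int: "\<And>t. t > 0 \<Longrightarrow> integrable lborel (\<lambda>u. exp (t * \<psi> u))"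
  shows "\<exists>Y. levy_with_density M Y \<psi>"
proof -
  interpret prob_space M using levy by (simp add: levy_process_def)
  have Xm: "\<And>t. 0 \<le> t \<Longrightarrow> X t \<in> borel_measurable M"
    and ind: "\<And>n (t :: nat \<Rightarrow> real). 0 \<le> t 0 \<Longrightarrow> (\<And>i. i < n \<Longrightarrow> t i < t (Suc i)) \<Longrightarrow>
        indep_vars (\<lambda>_. borel) (\<lambda>i \<omega>. X (t (Suc i)) \<omega> - X (t i) \<omega>) {..<n}"
    and stat: "\<And>s t. 0 \<le> s \<Longrightarrow> 0 \<le> t \<Longrightarrow> distr M borel (\<lambda>\<omega>. X (s + t) \<omega> - X s \<omega>) = distr M borel (X t)"
    using levy unfolding levy_process_def by auto
  have "AE \<omega> in M. X 0 \<omega> = 0 \<and> cadlag (\<lambda>t. X t \<omega>)" using levy unfolding levy_process_def by auto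
  then obtain N where N: "{\<omega>\<in>space M. \<not> (X 0 \<omega> = 0 \<and> cadlag (\<lambda>t. X t \<omega>))} \<subseteq> N" "N \<in> null_sets M"
    unfolding eventually_ae_filter by blast
  define Y where "Y t \<omega> = (if \<omega> \<in> N then 0 else X t \<omega>)" for t \<omega>
  have notN: "AE \<omega> in M. \<omega> \<notin> N" using N(2) by (rule AE_not_in)
  have [measurable]: "N \<in> sets M" using N(2) by auto
  have Ym: "Y t \<in> borel_measurable M" if "0 \<le> t" for t
  proof -
    have [measurable]: "X t \<in> borel_measurable M" using that by (rule Xm)
    show ?thesis unfolding Y_def by measurable
  qed
  have "levy_with_density M Y \<psi>"
  proof
    fix t :: real assume "0 \<le> t" then show "Y t \<in> borel_measurable M" by (rule Ym)
  next
    fix \<omega> assume "\<omega> \<in> space M" then show "Y 0 \<omega> = 0" using N(1) by (auto simp: Y_def)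
  next
    fix t :: real and \<omega> assume "0 \<le> t" "\<omega> \<in> space M"
    then show "continuous (at_right t) (\<lambda>t. Y t \<omega>)"
      using N(1) by (cases "\<omega> \<in> N") (auto simp: Y_def cadlag_def)
  next
    fix v :: "nat \<Rightarrow> real" and n assume v: "0 \<le> v 0" "\<And>i. i < n \<Longrightarrow> v i < v (Suc i)"
    have v0: "0 \<le> v i" if "i \<le> n" for i
      using that
    proof (induction i)
      case (Suc i)
      then show ?case using v(2)[of i] by auto
    qed (simp add: v(1))
    show "indep_vars (\<lambda>_. borel) (\<lambda>i \<omega>. Y (v (Suc i)) \<omega> - Y (v i) \<omega>) {..<n}"
    proof (rule indep_vars_cong_AE[OF ind[OF v]])
      fix i assume i: "i \<in> {..<n}"
      show "AE \<omega> in M. X (v (Suc i)) \<omega> - X (v i) \<omega> = Y (v (Suc i)) \<omega> - Y (v i) \<omega>"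
        using notN by eventually_elim (simp add: Y_def)
      show "(\<lambda>\<omega>. Y (v (Suc i)) \<omega> - Y (v i) \<omega>) \<in> borel_measurable M"
        using i by (intro borel_measurable_diff Ym v0) auto
    qed auto
  next
    fix a s :: real assume a: "0 \<le> a" "0 < s"
    have "distr M borel (\<lambda>\<omega>. Y (a + s) \<omega> - Y a \<omega>) = distr M borel (\<lambda>\<omega>. X (a + s) \<omega> - X a \<omega>)"
    proof (rule distr_cong_AE)
      show "AE \<omega> in M. Y (a + s) \<omega> - Y a \<omega> = X (a + s) \<omega> - X a \<omega>"
        using notN by eventually_elim (simp add: Y_def)
    qed (use a in \<open>auto intro!: borel_measurable_diff Ym Xm\<close>)
    also have "\<dots> = distr M borel (X s)" using a by (intro stat) auto
    also have "\<dots> = density lborel (\<lambda>x. ennreal (levy_density \<psi> s x))"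
    proof -
      have rd: "real_distribution (distr M borel (X s))" using a by (intro real_distribution_distr Xm) auto
      have ch: "char (distr M borel (X s)) u = complex_of_real (exp (s * \<psi> u))" for u
        using ce a unfolding char_exponent_def by auto
      have "integrable lborel (char (distr M borel (X s)))"
        unfolding ch[abs_def] using int[OF a(2)] by (rule integrable_of_real)
      from real_distribution.density_inversion_density[OF rd this]
      show ?thesis by (simp only: inversion_density_eq_levy_density[OF rd ch int[OF a(2)]])
    qed
    finally show "distr M borel (\<lambda>\<omega>. Y (a + s) \<omega> - Y a \<omega>) = density lborel (\<lambda>x. ennreal (levy_density \<psi> s x))" .
  next
    fix s x :: real assume s: "0 < s"
    have rd: "real_distribution (distr M borel (X s))" using s by (intro real_distribution_distr Xm) auto
    have ch: "char (distr M borel (X s)) u = complex_of_real (exp (s * \<psi> u))" for u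
      using ce s unfolding char_exponent_def by auto
    have "integrable lborel (char (distr M borel (X s)))"
      unfolding ch[abs_def] using int[OF s] by (rule integrable_of_real)
    from real_distribution.inversion_density_nonneg[OF rd this]
    show "0 \<le> levy_density \<psi> s x" by (simp only: inversion_density_eq_levy_density[OF rd ch int[OF s]])
  next
    have "(\<lambda>u. exp (1 * \<psi> u)) \<in> borel_measurable borel"
      using borel_measurable_integrable[OF int[of 1]] by simp
    then have "(\<lambda>u. ln (exp (1 * \<psi> u))) \<in> borel_measurable borel" by measurable
    then show "\<psi> \<in> borel_measurable borel" by simp
  qed
  then show ?thesis by blast
qed


section \<open>The bridge of random length before and after its length\<close>

text \<open>\<open>\<kappa> r\<close> is the law of the bridge of length \<open>r\<close>. \<open>X\<close> and \<open>\<zeta>\<close> live on one probability space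
  and are compared only through their laws.\<close>

locale random_bridge = levy_with_density M X \<psi>
  for M :: "'a measure" and X :: "real \<Rightarrow> 'a \<Rightarrow> real" and \<psi> :: "real \<Rightarrow> real" +
  fixes \<tau> :: "'a \<Rightarrow> real" and z :: real and \<zeta> :: "real \<Rightarrow> 'a \<Rightarrow> real" and \<kappa> :: "real \<Rightarrow> (real \<Rightarrow> real) measure"
  assumes length_measurable [measurable]: "\<tau> \<in> borel_measurable M"
    and length_pos: "\<omega> \<in> space M \<Longrightarrow> 0 < \<tau> \<omega>"
    and bridge_measurable: "0 \<le> t \<Longrightarrow> \<zeta> t \<in> borel_measurable M"
    and bridge_cond_law: "cond_distribution M skorohod_space (path \<zeta>) borel \<tau> \<kappa>"
    and kernel_bridge: "AE r in distr M borel \<tau>. levy_bridge \<psi> r z (\<kappa> r) (\<lambda>t w. w t)"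
begin

abbreviation P\<tau> :: "real measure" where "P\<tau> \<equiv> distr M borel \<tau>"

lemma bridge_path_measurable: "J \<subseteq> {0..} \<Longrightarrow> (\<lambda>\<omega> q. \<zeta> q \<omega>) \<in> measurable M (hist J)"
  by (rule measurable_histI) (auto intro: bridge_measurable)

lemma joint_law:
  assumes "B \<in> sets (hist {0..})" "R \<in> sets borel"
  shows "emeasure M {\<omega>\<in>space M. \<tau> \<omega> \<in> R \<and> (\<lambda>q. \<zeta> q \<omega>) \<in> B}
    = (\<integral>\<^sup>+r. indicator R r * emeasure (\<kappa> r) {w\<in>space (\<kappa> r). w \<in> B} \<partial>P\<tau>)"
proof -
  let ?S = "skorohod_space" and ?B = "{w\<in>space skorohod_space. w \<in> B}"
  have "(\<lambda>w. w) \<in> measurable ?S (hist {0..})"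
  proof (rule measurable_histI)
    fix q :: real assume "q \<in> {0..}"
    then show "(\<lambda>w. w q) \<in> borel_measurable ?S"
      unfolding skorohod_space_def by (intro measurable_restrict_space1 measurable_component_singleton)
  qed
  then have B: "?B \<in> sets ?S" using assms(1) by (rule measurable_event)
  have path: "path \<zeta> \<in> measurable M ?S" and \<kappa>: "\<kappa> \<in> measurable borel (prob_algebra ?S)"
    and law: "emeasure M {\<omega>\<in>space M. \<tau> \<omega> \<in> R \<and> path \<zeta> \<omega> \<in> ?B} = (\<integral>\<^sup>+r\<in>R. emeasure (\<kappa> r) ?B \<partial>P\<tau>)"
    using bridge_cond_law assms(2) B unfolding cond_distribution_def by blast+
  have "space (\<kappa> r) = space ?S" for r
    using measurable_space[OF \<kappa>, of r] by (auto simp: space_prob_algebra dest: sets_eq_imp_space_eq)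
  moreover have "path \<zeta> \<omega> \<in> ?B \<longleftrightarrow> (\<lambda>q. \<zeta> q \<omega>) \<in> B" if "\<omega> \<in> space M" for \<omega>
    using measurable_space[OF path that] hist_determined[OF assms(1), of "path \<zeta> \<omega>" "\<lambda>q. \<zeta> q \<omega>"]
    by (auto simp: path_def)
  then have "{\<omega>\<in>space M. \<tau> \<omega> \<in> R \<and> path \<zeta> \<omega> \<in> ?B} = {\<omega>\<in>space M. \<tau> \<omega> \<in> R \<and> (\<lambda>q. \<zeta> q \<omega>) \<in> B}"
    by auto
  ultimately show ?thesis using law by (simp add: mult.commute)
qed

text \<open>The average over the lengths in \<open>R\<close> of the h-transform weights at time \<open>s\<close>.\<close>

definition bridge_weight :: "real \<Rightarrow> real set \<Rightarrow> real \<Rightarrow> ennreal" where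
  "bridge_weight s R x = (\<integral>\<^sup>+r. indicator R r * ennreal (f (r - s) (z - x) / f r z) \<partial>P\<tau>)"

lemma prob_space_length_law: "prob_space P\<tau>"
  by (rule prob_space_distr) measurable

lemma bridge_weight_measurable [measurable]: "R \<in> sets borel \<Longrightarrow> bridge_weight s R \<in> borel_measurable borel"
proof -
  assume [measurable]: "R \<in> sets borel"
  interpret P: prob_space P\<tau> by (rule prob_space_length_law)
  have "(\<lambda>x. \<integral>\<^sup>+r. indicator R r * ennreal (f (r - s) (z - x) / f r z) \<partial>P\<tau>) \<in> borel_measurable borel"
    by measurable
  then show ?thesis unfolding bridge_weight_def .
qed

lemma law_before_length:
  assumes s: "0 \<le> s" and R [measurable]: "R \<in> sets borel" and Rs: "R \<subseteq> {s<..}" and B [measurable]: "B \<in> sets (hist {0..s})"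
  shows "emeasure M {\<omega>\<in>space M. \<tau> \<omega> \<in> R \<and> (\<lambda>q. \<zeta> q \<omega>) \<in> B}
    = (\<integral>\<^sup>+\<omega>. indicator B (\<lambda>q. X q \<omega>) * bridge_weight s R (X s \<omega>) \<partial>M)"
proof -
  interpret P: prob_space P\<tau> by (rule prob_space_length_law)
  interpret MP: pair_sigma_finite M P\<tau> ..
  have [measurable]: "(\<lambda>\<omega> q. X q \<omega>) \<in> measurable M (hist {0..s})" by (rule path_measurable) auto
  have [measurable]: "X s \<in> borel_measurable M" using s by (rule X_measurable)
  have "B \<in> sets (hist {0..})" using sets_hist_mono[of "{0..s}" "{0..}"] B by auto
  from joint_law[OF this R]
  have "emeasure M {\<omega>\<in>space M. \<tau> \<omega> \<in> R \<and> (\<lambda>q. \<zeta> q \<omega>) \<in> B}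
    = (\<integral>\<^sup>+r. indicator R r * emeasure (\<kappa> r) {w\<in>space (\<kappa> r). w \<in> B} \<partial>P\<tau>)" .
  also have "\<dots> = (\<integral>\<^sup>+r. indicator R r * (\<integral>\<^sup>+\<omega>. indicator B (\<lambda>q. X q \<omega>) * ennreal (f (r - s) (z - X s \<omega>) / f r z) \<partial>M) \<partial>P\<tau>)"
  proof (rule nn_integral_cong_AE)
    show "AE r in P\<tau>. indicator R r * emeasure (\<kappa> r) {w\<in>space (\<kappa> r). w \<in> B}
      = indicator R r * (\<integral>\<^sup>+\<omega>. indicator B (\<lambda>q. X q \<omega>) * ennreal (f (r - s) (z - X s \<omega>) / f r z) \<partial>M)"
      using kernel_bridge
    proof eventually_elim
      case (elim r)
      show ?case
      proof (cases "r \<in> R")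
        case True
        then have "s < r" using Rs by auto
        from bridge_law[OF elim s this B] show ?thesis by simp
      qed simp
    qed
  qed
  also have "\<dots> = (\<integral>\<^sup>+r. (\<integral>\<^sup>+\<omega>. indicator R r * (indicator B (\<lambda>q. X q \<omega>) * ennreal (f (r - s) (z - X s \<omega>) / f r z)) \<partial>M) \<partial>P\<tau>)"
    by (intro nn_integral_cong nn_integral_cmult[symmetric]) measurable
  also have "\<dots> = (\<integral>\<^sup>+\<omega>. (\<integral>\<^sup>+r. indicator R r * (indicator B (\<lambda>q. X q \<omega>) * ennreal (f (r - s) (z - X s \<omega>) / f r z)) \<partial>P\<tau>) \<partial>M)"
    by (rule MP.Fubini') measurable
  also have "\<dots> = (\<integral>\<^sup>+\<omega>. indicator B (\<lambda>q. X q \<omega>) * bridge_weight s R (X s \<omega>) \<partial>M)"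
  proof (rule nn_integral_cong)
    fix \<omega>
    have "(\<integral>\<^sup>+r. indicator R r * (indicator B (\<lambda>q. X q \<omega>) * ennreal (f (r - s) (z - X s \<omega>) / f r z)) \<partial>P\<tau>)
      = (\<integral>\<^sup>+r. indicator B (\<lambda>q. X q \<omega>) * (indicator R r * ennreal (f (r - s) (z - X s \<omega>) / f r z)) \<partial>P\<tau>)"
      by (intro nn_integral_cong) (simp add: mult_ac)
    also have "\<dots> = indicator B (\<lambda>q. X q \<omega>) * bridge_weight s R (X s \<omega>)"
      unfolding bridge_weight_def by (rule nn_integral_cmult) measurable
    finally show "(\<integral>\<^sup>+r. indicator R r * (indicator B (\<lambda>q. X q \<omega>) * ennreal (f (r - s) (z - X s \<omega>) / f r z)) \<partial>P\<tau>) = \<dots>" .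
  qed
  finally show ?thesis .
qed

text \<open>On the history of \<open>s\<close>, the law of \<open>\<zeta>\<close> restricted to \<open>{\<tau> \<in> R}\<close> has density \<open>bridge_weight s R (X\<^sub>s)\<close> with
  respect to the law of \<open>X\<close>.\<close>

lemma nn_integral_before_length:
  assumes s: "0 \<le> s" and R [measurable]: "R \<in> sets borel" and Rs: "R \<subseteq> {s<..}"
    and h [measurable]: "h \<in> borel_measurable (hist {0..s})"
  shows "(\<integral>\<^sup>+\<omega>. indicator R (\<tau> \<omega>) * h (\<lambda>q. \<zeta> q \<omega>) \<partial>M) = (\<integral>\<^sup>+\<omega>. bridge_weight s R (X s \<omega>) * h (\<lambda>q. X q \<omega>) \<partial>M)"
proof -
  have [measurable]: "(\<lambda>\<omega> q. X q \<omega>) \<in> measurable M (hist {0..s})" by (rule path_measurable) auto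
  have [measurable]: "(\<lambda>\<omega> q. \<zeta> q \<omega>) \<in> measurable M (hist {0..s})" by (rule bridge_path_measurable) auto
  have [measurable]: "X s \<in> borel_measurable M" using s by (rule X_measurable)
  let ?\<mu> = "distr (density M (\<lambda>\<omega>. indicator R (\<tau> \<omega>))) (hist {0..s}) (\<lambda>\<omega> q. \<zeta> q \<omega>)"
  let ?\<nu> = "distr (density M (\<lambda>\<omega>. bridge_weight s R (X s \<omega>))) (hist {0..s}) (\<lambda>\<omega> q. X q \<omega>)"
  have eq: "?\<mu> = ?\<nu>"
  proof (rule measure_eqI)
    fix B assume "B \<in> sets ?\<mu>"
    then have B [measurable]: "B \<in> sets (hist {0..s})" by simp
    have 1: "{\<omega>\<in>space M. \<tau> \<omega> \<in> R \<and> (\<lambda>q. \<zeta> q \<omega>) \<in> B} \<in> sets M" by measurable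
    have "emeasure ?\<mu> B = (\<integral>\<^sup>+w. indicator B w \<partial>?\<mu>)" by simp
    also have "\<dots> = (\<integral>\<^sup>+\<omega>. indicator R (\<tau> \<omega>) * indicator B (\<lambda>q. \<zeta> q \<omega>) \<partial>M)"
      by (subst nn_integral_distr) (auto simp: nn_integral_density)
    also have "\<dots> = (\<integral>\<^sup>+\<omega>. indicator {\<omega>\<in>space M. \<tau> \<omega> \<in> R \<and> (\<lambda>q. \<zeta> q \<omega>) \<in> B} \<omega> \<partial>M)"
      by (intro nn_integral_cong) (auto split: split_indicator)
    also have "\<dots> = emeasure M {\<omega>\<in>space M. \<tau> \<omega> \<in> R \<and> (\<lambda>q. \<zeta> q \<omega>) \<in> B}"
      using 1 by (rule nn_integral_indicator)
    also have "\<dots> = (\<integral>\<^sup>+\<omega>. indicator B (\<lambda>q. X q \<omega>) * bridge_weight s R (X s \<omega>) \<partial>M)"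
      by (rule law_before_length[OF s R Rs B])
    also have "\<dots> = (\<integral>\<^sup>+w. indicator B w \<partial>?\<nu>)"
      by (subst nn_integral_distr) (auto simp: nn_integral_density mult.commute)
    finally show "emeasure ?\<mu> B = emeasure ?\<nu> B" by simp
  qed simp
  have "(\<integral>\<^sup>+\<omega>. indicator R (\<tau> \<omega>) * h (\<lambda>q. \<zeta> q \<omega>) \<partial>M) = (\<integral>\<^sup>+w. h w \<partial>?\<mu>)"
    by (subst nn_integral_distr) (auto simp: nn_integral_density)
  also have "\<dots> = (\<integral>\<^sup>+\<omega>. bridge_weight s R (X s \<omega>) * h (\<lambda>q. X q \<omega>) \<partial>M)"
    unfolding eq by (subst nn_integral_distr) (auto simp: nn_integral_density)
  finally show ?thesis .
qed

text \<open>The form of absolute continuity that transfers almost sure statements from \<open>X\<close> to \<open>\<zeta>\<close>.\<close>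

lemma AE_before_length:
  assumes s: "0 \<le> s" and B: "B \<in> sets (hist {0..s})" and "AE \<omega> in M. (\<lambda>q. X q \<omega>) \<notin> B"
  shows "AE \<omega> in M. s < \<tau> \<omega> \<longrightarrow> (\<lambda>q. \<zeta> q \<omega>) \<notin> B"
proof -
  have "emeasure M {\<omega>\<in>space M. \<tau> \<omega> \<in> {s<..} \<and> (\<lambda>q. \<zeta> q \<omega>) \<in> B}
      = (\<integral>\<^sup>+\<omega>. indicator B (\<lambda>q. X q \<omega>) * bridge_weight s {s<..} (X s \<omega>) \<partial>M)"
    by (rule law_before_length[OF s _ _ B]) auto
  also have "\<dots> = (\<integral>\<^sup>+\<omega>. 0 \<partial>M)"
    by (rule nn_integral_cong_AE) (use assms(3) in \<open>eventually_elim, simp\<close>)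
  finally have "emeasure M {\<omega>\<in>space M. \<tau> \<omega> \<in> {s<..} \<and> (\<lambda>q. \<zeta> q \<omega>) \<in> B} = 0" by simp
  moreover have [measurable]: "(\<lambda>\<omega> q. \<zeta> q \<omega>) \<in> measurable M (hist {0..s})" by (rule bridge_path_measurable) auto
  have "{\<omega>\<in>space M. \<tau> \<omega> \<in> {s<..} \<and> (\<lambda>q. \<zeta> q \<omega>) \<in> B} \<in> sets M" using B by measurable
  ultimately have "{\<omega>\<in>space M. \<tau> \<omega> \<in> {s<..} \<and> (\<lambda>q. \<zeta> q \<omega>) \<in> B} \<in> null_sets M" by blast
  from AE_not_in[OF this] AE_space show ?thesis by eventually_elim auto
qed

lemma AE_after_length:
  assumes "0 \<le> q"
  shows "AE \<omega> in M. \<tau> \<omega> \<le> q \<longrightarrow> \<zeta> q \<omega> = z"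
proof -
  let ?B = "{w. w q \<in> - {z}} :: (real \<Rightarrow> real) set"
  have B: "?B \<in> sets (hist {0..})" using assms by (intro coordinate_event_in_hist) auto
  have "emeasure M {\<omega>\<in>space M. \<tau> \<omega> \<in> {..q} \<and> (\<lambda>q. \<zeta> q \<omega>) \<in> ?B}
    = (\<integral>\<^sup>+r. indicator {..q} r * emeasure (\<kappa> r) {w\<in>space (\<kappa> r). w \<in> ?B} \<partial>P\<tau>)"
    by (rule joint_law[OF B]) simp
  also have "\<dots> = (\<integral>\<^sup>+r. 0 \<partial>P\<tau>)"
  proof (rule nn_integral_cong_AE)
    show "AE r in P\<tau>. indicator {..q} r * emeasure (\<kappa> r) {w\<in>space (\<kappa> r). w \<in> ?B} = 0"
      using kernel_bridge
    proof eventually_elim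
      case (elim r)
      then have "AE w in \<kappa> r. \<forall>t\<ge>r. w t = z" by (simp add: levy_bridge_def)
      then have "AE w in \<kappa> r. w \<notin> ?B" if "r \<le> q"
        by (rule eventually_mono) (use that in simp)
      then have "emeasure (\<kappa> r) {w\<in>space (\<kappa> r). w \<in> ?B} = 0" if "r \<le> q"
        using that by (intro emeasure_eq_0_AE)
      then show ?case by (simp add: indicator_def)
    qed
  qed
  finally have "emeasure M {\<omega>\<in>space M. \<tau> \<omega> \<in> {..q} \<and> (\<lambda>q. \<zeta> q \<omega>) \<in> ?B} = 0" by simp
  moreover have [measurable]: "\<zeta> q \<in> borel_measurable M" using assms by (rule bridge_measurable)
  have "{\<omega>\<in>space M. \<tau> \<omega> \<in> {..q} \<and> (\<lambda>q. \<zeta> q \<omega>) \<in> ?B} \<in> sets M" by measurable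
  ultimately have "{\<omega>\<in>space M. \<tau> \<omega> \<in> {..q} \<and> (\<lambda>q. \<zeta> q \<omega>) \<in> ?B} \<in> null_sets M" by blast
  from AE_not_in[OF this] AE_space show ?thesis by eventually_elim auto
qed

lemma AE_X_neq:
  assumes "0 < t"
  shows "AE \<omega> in M. X t \<omega> \<noteq> x"
proof -
  have [measurable]: "X 0 \<in> borel_measurable M" "X t \<in> borel_measurable M" using assms by (auto intro: X_measurable)
  have "AE y in distr M borel (\<lambda>\<omega>. X (0 + t) \<omega> - X 0 \<omega>). y \<noteq> x"
    unfolding increment_density[OF order_refl assms] using AE_lborel_singleton[of x] by (auto simp: AE_density elim: eventually_mono)
  then have "AE \<omega> in M. X t \<omega> - X 0 \<omega> \<noteq> x"
    by (subst (asm) AE_distr_iff) auto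
  then show ?thesis using AE_space by eventually_elim (simp add: X_0)
qed

text \<open>Before its length the bridge avoids \<open>z\<close> at a fixed time \<open>t > 0\<close>, as \<open>X\<^sub>t\<close> has no atom at \<open>z\<close>. At \<open>t = 0\<close>
  the value \<open>\<zeta>\<^sub>0\<close> says nothing when \<open>z = 0\<close>, but there \<open>\<tau> > 0\<close> decides.\<close>

lemma AE_length_le_iff:
  assumes "0 \<le> t"
  shows "AE \<omega> in M. \<tau> \<omega> \<le> t \<longleftrightarrow> 0 < t \<and> \<zeta> t \<omega> = z"
proof (cases "t = 0")
  case True
  show ?thesis using AE_space by eventually_elim (use length_pos True in force)
next
  case False
  then have t: "0 < t" using assms by simp
  have "AE \<omega> in M. t < \<tau> \<omega> \<longrightarrow> (\<lambda>q. \<zeta> q \<omega>) \<notin> {w. w t \<in> {z}}"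
  proof (rule AE_before_length[OF assms])
    show "{w. w t \<in> {z}} \<in> sets (hist {0..t})" using assms by (intro coordinate_event_in_hist) auto
    show "AE \<omega> in M. (\<lambda>q. X q \<omega>) \<notin> {w. w t \<in> {z}}" using AE_X_neq[OF t, of z] by eventually_elim simp
  qed
  then show ?thesis using AE_after_length[OF assms] by eventually_elim (use t in auto)
qed

section \<open>Right-continuity of the completed filtration\<close>

lemma bridge_filtration_iff:
  "A \<in> sets (completed_filtration M \<zeta> t) \<longleftrightarrow>
    A \<in> sets M \<and> (\<exists>B\<in>sets (hist {0..t}). AE \<omega> in M. \<omega> \<in> A \<longleftrightarrow> (\<lambda>q. \<zeta> q \<omega>) \<in> B)"
  by (rule sets_completed_filtration_iff) (rule bridge_measurable)

lemma stop_measurable: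
  assumes "0 \<le> t"
  shows "(\<lambda>w q. w (min q t)) \<in> measurable (hist {0..t}) (hist {0..})"
  using assms by (intro measurable_histI measurable_hist_coordinate) auto

text \<open>The value at each single time after \<open>t\<close> is \<open>z\<close> up to a null set that depends on the time. Induction
  over the generation of \<open>B\<close> needs only countably many of these null sets.\<close>

lemma AE_stopped:
  assumes t: "0 \<le> t" and "B \<in> sets (hist {0..})"
  shows "AE \<omega> in M. \<tau> \<omega> \<le> t \<longrightarrow> ((\<lambda>q. \<zeta> q \<omega>) \<in> B \<longleftrightarrow> (\<lambda>q. \<zeta> (min q t) \<omega>) \<in> B)"
  using assms(2) unfolding sets_hist
proof induction
  case (Basic B)
  then obtain q A where B: "B = {w. w q \<in> A}" "0 \<le> q" by auto
  show ?case
  proof (cases "q \<le> t")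
    case True
    then show ?thesis by (simp add: B min_def)
  next
    case False
    show ?thesis using AE_after_length[OF t] AE_after_length[OF B(2)]
      by eventually_elim (use False in \<open>auto simp: B min_def\<close>)
  qed
next
  case (Compl B)
  then show ?case by (auto elim: eventually_mono)
next
  case (Union B)
  then have "AE \<omega> in M. \<forall>i. \<tau> \<omega> \<le> t \<longrightarrow> ((\<lambda>q. \<zeta> q \<omega>) \<in> B i \<longleftrightarrow> (\<lambda>q. \<zeta> (min q t) \<omega>) \<in> B i)"
    unfolding AE_all_countable by blast
  then show ?case by eventually_elim auto
qed simp

text \<open>One set \<open>L\<close> of paths has to serve all windows \<open>[0, t + 1/(n+1)]\<close> simultaneously, since absolute
  continuity goes only from \<open>X\<close> to \<open>\<zeta>\<close>: sets representing the same event for \<open>\<zeta>\<close> need not agree almost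
  surely for \<open>X\<close>. The limes superior of the representing sets does this.\<close>

theorem completed_filtration_right_continuous:
  assumes t: "0 \<le> t"
  shows "(\<Inter>s\<in>{t<..}. sets (completed_filtration M \<zeta> s)) = sets (completed_filtration M \<zeta> t)"
proof (intro equalityI subsetI)
  fix A assume "A \<in> sets (completed_filtration M \<zeta> t)"
  then obtain B where "A \<in> sets M" "B \<in> sets (hist {0..t})" "AE \<omega> in M. \<omega> \<in> A \<longleftrightarrow> (\<lambda>q. \<zeta> q \<omega>) \<in> B"
    unfolding bridge_filtration_iff by blast
  moreover have "sets (hist {0..t}) \<subseteq> sets (hist {0..s})" if "t < s" for s
    using that by (intro sets_hist_mono) auto
  ultimately show "A \<in> (\<Inter>s\<in>{t<..}. sets (completed_filtration M \<zeta> s))"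
    unfolding INT_iff bridge_filtration_iff by blast
next
  fix A assume A: "A \<in> (\<Inter>s\<in>{t<..}. sets (completed_filtration M \<zeta> s))"
  let ?X = "\<lambda>\<omega> q. X q \<omega>" and ?Z = "\<lambda>\<omega> q. \<zeta> q \<omega>"
  define s where "s n = t + 1 / real (Suc n)" for n
  have s: "t < s n" "0 \<le> s n" for n using t by (auto simp: s_def intro: add_nonneg_nonneg)
  have s_antimono: "s m \<le> s n" if "n \<le> m" for m n
    using that by (auto simp: s_def intro!: divide_left_mono)
  have s_lim: "s \<longlonglongrightarrow> t"
    unfolding s_def using LIMSEQ_inverse_real_of_nat_add[of t] by (simp add: inverse_eq_divide)
  have "\<exists>B\<in>sets (hist {0..s n}). AE \<omega> in M. \<omega> \<in> A \<longleftrightarrow> ?Z \<omega> \<in> B" for n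
    using A s(1)[of n] unfolding INT_iff bridge_filtration_iff by blast
  then obtain B where B: "\<And>n. B n \<in> sets (hist {0..s n})" and AB: "\<And>n. AE \<omega> in M. \<omega> \<in> A \<longleftrightarrow> ?Z \<omega> \<in> B n"
    by metis
  have A_M: "A \<in> sets M"
    using A s(1)[of 0] unfolding INT_iff bridge_filtration_iff by blast
  define L where "L = (\<Inter>m. \<Union>n\<in>{m..}. B n)"
  have L_eq: "L = (\<Inter>m. \<Union>n\<in>{max k m..}. B n)" for k
    unfolding L_def
  proof (rule antisym; rule INF_greatest)
    show "(\<Inter>m. \<Union>n\<in>{m..}. B n) \<subseteq> (\<Union>n\<in>{max k m..}. B n)" for m
      by (rule INF_lower2[of "max k m"]) auto
    show "(\<Inter>m. \<Union>n\<in>{max k m..}. B n) \<subseteq> (\<Union>n\<in>{m..}. B n)" for m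
      by (rule INF_lower2[of m]) auto
  qed
  have L: "L \<in> sets (hist {0..s k})" for k
  proof -
    have "B n \<in> sets (hist {0..s k})" if "max k m \<le> n" for n m
      using B[of n] sets_hist_mono[of "{0..s n}" "{0..s k}"] s_antimono[of k n] that by auto
    then show ?thesis unfolding L_eq[of k] by (intro sets.countable_INT sets.countable_UN'') auto
  qed
  have "AE \<omega> in M. \<forall>n. \<omega> \<in> A \<longleftrightarrow> ?Z \<omega> \<in> B n" unfolding AE_all_countable using AB by blast
  then have AL: "AE \<omega> in M. \<omega> \<in> A \<longleftrightarrow> ?Z \<omega> \<in> L"
    by eventually_elim (auto simp: L_def)
  obtain L' where L': "L' \<in> sets (hist {0..t})" "AE \<omega> in M. ?X \<omega> \<in> L \<longleftrightarrow> ?X \<omega> \<in> L'"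
    using germ_event_is_past_event[OF t, of L] L unfolding s_def by blast
  have "AE \<omega> in M. s k < \<tau> \<omega> \<longrightarrow> ?Z \<omega> \<notin> (L - L') \<union> (L' - L)" for k
  proof (rule AE_before_length[OF s(2)])
    show "(L - L') \<union> (L' - L) \<in> sets (hist {0..s k})"
      using L[of k] L'(1) sets_hist_mono[of "{0..t}" "{0..s k}"] s(1)[of k] by auto
    show "AE \<omega> in M. ?X \<omega> \<notin> (L - L') \<union> (L' - L)"
      using L'(2) by eventually_elim auto
  qed
  then have "AE \<omega> in M. \<forall>k. s k < \<tau> \<omega> \<longrightarrow> ?Z \<omega> \<notin> (L - L') \<union> (L' - L)"
    unfolding AE_all_countable by blast
  then have before: "AE \<omega> in M. t < \<tau> \<omega> \<longrightarrow> (?Z \<omega> \<in> L \<longleftrightarrow> ?Z \<omega> \<in> L')"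
  proof eventually_elim
    case (elim \<omega>)
    show ?case
    proof
      assume "t < \<tau> \<omega>"
      then have "eventually (\<lambda>k. s k < \<tau> \<omega>) sequentially" using order_tendstoD(2)[OF s_lim] by simp
      then obtain k where "s k < \<tau> \<omega>" unfolding eventually_sequentially by blast
      then show "?Z \<omega> \<in> L \<longleftrightarrow> ?Z \<omega> \<in> L'" using elim by blast
    qed
  qed
  let ?stop = "\<lambda>(w :: real \<Rightarrow> real) q. w (min q t)"
  have L0: "L \<in> sets (hist {0..})" using L[of 0] sets_hist_mono[of "{0..s 0}" "{0..}"] by auto
  define C where "C = (if 0 < t then {w. w t \<in> {z}} else {})"
  have C: "C \<in> sets (hist {0..t})"
    unfolding C_def using t coordinate_event_in_hist[of t "{0..t}" "{z}"] by auto
  (* C is the event that the length has passed; there L is tested on the stopped path. *)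
  define D where "D = (C \<inter> ?stop -` L) \<union> (L' - C)"
  have "?stop -` L \<in> sets (hist {0..t})"
    using measurable_sets[OF stop_measurable[OF t] L0] by simp
  then have D: "D \<in> sets (hist {0..t})" unfolding D_def using C L'(1) by auto
  have "AE \<omega> in M. \<omega> \<in> A \<longleftrightarrow> ?Z \<omega> \<in> D"
    using AL before AE_stopped[OF t L0] AE_length_le_iff[OF t]
    by eventually_elim (auto simp: D_def C_def split: if_splits)
  then show "A \<in> sets (completed_filtration M \<zeta> t)"
    unfolding bridge_filtration_iff using A_M D by blast
qed

section \<open>The Markov property\<close>

text \<open>On \<open>{\<tau> > t}\<close>, the expectation of \<open>g(\<zeta>\<^sub>u)\<close> over \<open>{\<zeta> \<in> B}\<close> is the integral of \<open>N(X\<^sub>t)\<close> over \<open>{X \<in> B}\<close>, where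
  \<open>N\<close> adds the contributions of lengths beyond \<open>u\<close>, by the transition density from \<open>t\<close> to \<open>u\<close>, and of
  lengths in \<open>(t, u]\<close>, by \<open>g(z)\<close>. The expectation of \<open>h(\<zeta>\<^sub>t)\<close> is the integral of \<open>h(X\<^sub>t) D(X\<^sub>t)\<close>. So
  \<open>h = N / D\<close> makes the two agree.\<close>

lemma nonneg_transition_function:
  fixes g :: "real \<Rightarrow> real"
  assumes t: "0 \<le> t" "t < u" and g [measurable]: "g \<in> borel_measurable borel" and g0: "\<And>x. 0 \<le> g x" and gc: "\<And>x. g x \<le> c"
  shows "\<exists>H\<in>borel_measurable borel. (\<forall>x. 0 \<le> H x) \<and> (\<forall>B\<in>sets (hist {0..t}).
    (\<integral>\<^sup>+\<omega>. indicator B (\<lambda>q. \<zeta> q \<omega>) * ennreal (H (\<zeta> t \<omega>)) \<partial>M) = (\<integral>\<^sup>+\<omega>. indicator B (\<lambda>q. \<zeta> q \<omega>) * ennreal (g (\<zeta> u \<omega>)) \<partial>M))"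
proof -
  let ?X = "\<lambda>\<omega> q. X q \<omega>" and ?Z = "\<lambda>\<omega> q. \<zeta> q \<omega>"
  have u: "0 \<le> u" using t by simp
  have [measurable]: "?X \<in> measurable M (hist {0..t})" "?Z \<in> measurable M (hist {0..t})"
    by (auto intro: path_measurable bridge_path_measurable)
  have [measurable]: "X t \<in> borel_measurable M" "X u \<in> borel_measurable M" using t by (auto intro: X_measurable)
  have [measurable]: "\<zeta> t \<in> borel_measurable M" "\<zeta> u \<in> borel_measurable M" using t by (auto intro: bridge_measurable)
  have [measurable]: "(\<lambda>w. w t) \<in> borel_measurable (hist {0..t})"
    using t by (intro measurable_hist_coordinate) auto
  define \<Phi> where "\<Phi> x = (\<integral>\<^sup>+y. ennreal (f (u - t) (y - x)) * (ennreal (g y) * bridge_weight u {u<..} y) \<partial>lborel)" for x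
  define N where "N x = \<Phi> x + ennreal (g z) * bridge_weight t {t<..u} x" for x
  define D where "D x = bridge_weight t {t<..} x" for x
  have [measurable]: "\<Phi> \<in> borel_measurable borel" unfolding \<Phi>_def by measurable
  have [measurable]: "N \<in> borel_measurable borel" unfolding N_def by measurable
  have [measurable]: "D \<in> borel_measurable borel" unfolding D_def by measurable
  have num: "(\<integral>\<^sup>+\<omega>. indicator {t<..} (\<tau> \<omega>) * indicator B (?Z \<omega>) * ennreal (g (\<zeta> u \<omega>)) \<partial>M) = (\<integral>\<^sup>+\<omega>. indicator B (?X \<omega>) * N (X t \<omega>) \<partial>M)"
    if B [measurable]: "B \<in> sets (hist {0..t})" for B
  proof -
    have Bu: "B \<in> sets (hist {0..u})" using sets_hist_mono[of "{0..t}" "{0..u}"] t B by auto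
    have hu: "(\<lambda>w. indicator B w * ennreal (g (w u))) \<in> borel_measurable (hist {0..u})"
    proof -
      note Bu [measurable]
      have [measurable]: "(\<lambda>w. w u) \<in> borel_measurable (hist {0..u})"
        using u by (intro measurable_hist_coordinate) auto
      show ?thesis by measurable
    qed
    have "(\<integral>\<^sup>+\<omega>. indicator {t<..} (\<tau> \<omega>) * indicator B (?Z \<omega>) * ennreal (g (\<zeta> u \<omega>)) \<partial>M)
      = (\<integral>\<^sup>+\<omega>. indicator {u<..} (\<tau> \<omega>) * (indicator B (?Z \<omega>) * ennreal (g (\<zeta> u \<omega>)))
           + indicator {t<..u} (\<tau> \<omega>) * (indicator B (?Z \<omega>) * ennreal (g z)) \<partial>M)"
    proof (rule nn_integral_cong_AE)
      show "AE \<omega> in M. indicator {t<..} (\<tau> \<omega>) * indicator B (?Z \<omega>) * ennreal (g (\<zeta> u \<omega>))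
        = indicator {u<..} (\<tau> \<omega>) * (indicator B (?Z \<omega>) * ennreal (g (\<zeta> u \<omega>)))
           + indicator {t<..u} (\<tau> \<omega>) * (indicator B (?Z \<omega>) * ennreal (g z))"
        using AE_after_length[OF u]
        by eventually_elim (use t in \<open>auto split: split_indicator\<close>)
    qed
    also have "\<dots> = (\<integral>\<^sup>+\<omega>. indicator {u<..} (\<tau> \<omega>) * (indicator B (?Z \<omega>) * ennreal (g (\<zeta> u \<omega>))) \<partial>M)
        + (\<integral>\<^sup>+\<omega>. indicator {t<..u} (\<tau> \<omega>) * (indicator B (?Z \<omega>) * ennreal (g z)) \<partial>M)"
      by (rule nn_integral_add) measurable
    also have "(\<integral>\<^sup>+\<omega>. indicator {u<..} (\<tau> \<omega>) * (indicator B (?Z \<omega>) * ennreal (g (\<zeta> u \<omega>))) \<partial>M)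
      = (\<integral>\<^sup>+\<omega>. bridge_weight u {u<..} (X u \<omega>) * (indicator B (?X \<omega>) * ennreal (g (X u \<omega>))) \<partial>M)"
      by (rule nn_integral_before_length[OF u _ _ hu]) auto
    also have "\<dots> = (\<integral>\<^sup>+\<omega>. indicator B (?X \<omega>) * (ennreal (g (X u \<omega>)) * bridge_weight u {u<..} (X u \<omega>)) \<partial>M)"
      by (simp only: mult_ac)
    also have "\<dots> = (\<integral>\<^sup>+\<omega>. indicator B (?X \<omega>) * \<Phi> (X t \<omega>) \<partial>M)"
      unfolding \<Phi>_def by (rule expectation_given_past[OF t B]) measurable
    also have "(\<integral>\<^sup>+\<omega>. indicator {t<..u} (\<tau> \<omega>) * (indicator B (?Z \<omega>) * ennreal (g z)) \<partial>M)
      = (\<integral>\<^sup>+\<omega>. bridge_weight t {t<..u} (X t \<omega>) * (indicator B (?X \<omega>) * ennreal (g z)) \<partial>M)"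
      by (rule nn_integral_before_length[OF t(1)]) auto
    also have "(\<integral>\<^sup>+\<omega>. indicator B (?X \<omega>) * \<Phi> (X t \<omega>) \<partial>M) + \<dots>
      = (\<integral>\<^sup>+\<omega>. indicator B (?X \<omega>) * \<Phi> (X t \<omega>) + bridge_weight t {t<..u} (X t \<omega>) * (indicator B (?X \<omega>) * ennreal (g z)) \<partial>M)"
      by (rule nn_integral_add[symmetric]) measurable
    also have "\<dots> = (\<integral>\<^sup>+\<omega>. indicator B (?X \<omega>) * N (X t \<omega>) \<partial>M)"
      by (intro nn_integral_cong) (simp add: N_def distrib_left mult_ac)
    finally show ?thesis .
  qed
  have den: "(\<integral>\<^sup>+\<omega>. indicator {t<..} (\<tau> \<omega>) * indicator B (?Z \<omega>) * h (\<zeta> t \<omega>) \<partial>M) = (\<integral>\<^sup>+\<omega>. indicator B (?X \<omega>) * (h (X t \<omega>) * D (X t \<omega>)) \<partial>M)"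
    if B [measurable]: "B \<in> sets (hist {0..t})" and h [measurable]: "h \<in> borel_measurable borel" for B h
  proof -
    have "(\<integral>\<^sup>+\<omega>. indicator {t<..} (\<tau> \<omega>) * indicator B (?Z \<omega>) * h (\<zeta> t \<omega>) \<partial>M) = (\<integral>\<^sup>+\<omega>. indicator {t<..} (\<tau> \<omega>) * (indicator B (?Z \<omega>) * h (\<zeta> t \<omega>)) \<partial>M)"
      by (simp only: mult.assoc)
    also have "\<dots> = (\<integral>\<^sup>+\<omega>. bridge_weight t {t<..} (X t \<omega>) * (indicator B (?X \<omega>) * h (X t \<omega>)) \<partial>M)"
      by (rule nn_integral_before_length[OF t(1)]) auto
    finally show ?thesis by (simp only: D_def mult_ac)
  qed
  have UNIV_hist: "UNIV \<in> sets (hist {0..t})" using sets.top[of "hist {0..t}"] by simp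
  have D_fin: "AE \<omega> in M. D (X t \<omega>) \<noteq> \<infinity>"
  proof (rule nn_integral_PInf_AE)
    have "(\<integral>\<^sup>+\<omega>. D (X t \<omega>) \<partial>M) = (\<integral>\<^sup>+\<omega>. indicator {t<..} (\<tau> \<omega>) \<partial>M)"
      using den[OF UNIV_hist, of "\<lambda>_. 1"] by simp
    also have "\<dots> \<le> (\<integral>\<^sup>+\<omega>. 1 \<partial>M)" by (intro nn_integral_mono) (auto split: split_indicator)
    finally show "(\<integral>\<^sup>+\<omega>. D (X t \<omega>) \<partial>M) \<noteq> \<infinity>" by (auto simp: emeasure_space_1 top_unique)
  qed simp
  have le_c: "(\<integral>\<^sup>+\<omega>. indicator {t<..} (\<tau> \<omega>) * indicator B (?Z \<omega>) * ennreal (g (\<zeta> u \<omega>)) \<partial>M)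
      \<le> (\<integral>\<^sup>+\<omega>. indicator {t<..} (\<tau> \<omega>) * indicator B (?Z \<omega>) * ennreal c \<partial>M)" for B
    by (intro nn_integral_mono mult_left_mono ennreal_leI gc) auto
  (* Needed because 0 / 0 = 0: the quotient times D must give back N. *)
  have D0: "AE \<omega> in M. D (X t \<omega>) = 0 \<longrightarrow> N (X t \<omega>) = 0"
  proof -
    let ?B = "{w. w t \<in> {x. D x = 0}} :: (real \<Rightarrow> real) set"
    have D0_borel: "{x. D x = 0} \<in> sets borel" by measurable
    then have B: "?B \<in> sets (hist {0..t})" using t by (intro coordinate_event_in_hist) auto
    have "(\<integral>\<^sup>+\<omega>. indicator ?B (?X \<omega>) * N (X t \<omega>) \<partial>M) \<le> (\<integral>\<^sup>+\<omega>. indicator {t<..} (\<tau> \<omega>) * indicator ?B (?Z \<omega>) * ennreal c \<partial>M)"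
      using le_c[of ?B] unfolding num[OF B] .
    also have "\<dots> = (\<integral>\<^sup>+\<omega>. indicator ?B (?X \<omega>) * (ennreal c * D (X t \<omega>)) \<partial>M)"
      by (rule den[OF B]) measurable
    also have "\<dots> = (\<integral>\<^sup>+\<omega>. 0 \<partial>M)" by (intro nn_integral_cong) (auto split: split_indicator)
    finally have "(\<integral>\<^sup>+\<omega>. indicator ?B (?X \<omega>) * N (X t \<omega>) \<partial>M) = 0" by simp
    then have "AE \<omega> in M. indicator ?B (?X \<omega>) * N (X t \<omega>) = 0"
      using B by (subst (asm) nn_integral_0_iff_AE) auto
    then show ?thesis by eventually_elim (auto simp: indicator_def split: if_splits)
  qed
  have quot: "AE \<omega> in M. N (X t \<omega>) / D (X t \<omega>) * D (X t \<omega>) = N (X t \<omega>)"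
    using D_fin D0
  proof eventually_elim
    case (elim \<omega>)
    show ?case
    proof (cases "D (X t \<omega>) = 0")
      case False
      then have "D (X t \<omega>) / D (X t \<omega>) = 1"
        using elim(1) by (intro ennreal_divide_self) (auto simp: less_top)
      moreover have "N (X t \<omega>) / D (X t \<omega>) * D (X t \<omega>) = N (X t \<omega>) * (D (X t \<omega>) / D (X t \<omega>))"
        by (simp add: divide_ennreal_def mult_ac)
      ultimately show ?thesis by simp
    qed (use elim in simp)
  qed
  have ratio: "(\<integral>\<^sup>+\<omega>. indicator {t<..} (\<tau> \<omega>) * indicator B (?Z \<omega>) * (N (\<zeta> t \<omega>) / D (\<zeta> t \<omega>)) \<partial>M)
     = (\<integral>\<^sup>+\<omega>. indicator {t<..} (\<tau> \<omega>) * indicator B (?Z \<omega>) * ennreal (g (\<zeta> u \<omega>)) \<partial>M)"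
    if B: "B \<in> sets (hist {0..t})" for B
  proof -
    have "(\<integral>\<^sup>+\<omega>. indicator {t<..} (\<tau> \<omega>) * indicator B (?Z \<omega>) * (N (\<zeta> t \<omega>) / D (\<zeta> t \<omega>)) \<partial>M)
       = (\<integral>\<^sup>+\<omega>. indicator B (?X \<omega>) * (N (X t \<omega>) / D (X t \<omega>) * D (X t \<omega>)) \<partial>M)"
      by (rule den[OF B]) measurable
    also have "\<dots> = (\<integral>\<^sup>+\<omega>. indicator B (?X \<omega>) * N (X t \<omega>) \<partial>M)"
      by (rule nn_integral_cong_AE) (use quot in \<open>eventually_elim, simp\<close>)
    finally show ?thesis by (simp only: num[OF B])
  qed
  have ratio_fin: "AE \<omega> in M. t < \<tau> \<omega> \<longrightarrow> N (\<zeta> t \<omega>) / D (\<zeta> t \<omega>) < \<infinity>"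
  proof -
    have "AE \<omega> in M. indicator {t<..} (\<tau> \<omega>) * indicator UNIV (?Z \<omega>) * (N (\<zeta> t \<omega>) / D (\<zeta> t \<omega>)) \<noteq> \<infinity>"
    proof (rule nn_integral_PInf_AE)
      have "(\<integral>\<^sup>+\<omega>. indicator {t<..} (\<tau> \<omega>) * indicator UNIV (?Z \<omega>) * (N (\<zeta> t \<omega>) / D (\<zeta> t \<omega>)) \<partial>M)
        \<le> (\<integral>\<^sup>+\<omega>. indicator {t<..} (\<tau> \<omega>) * indicator UNIV (?Z \<omega>) * ennreal c \<partial>M)"
        unfolding ratio[OF UNIV_hist] by (rule le_c)
      also have "\<dots> \<le> (\<integral>\<^sup>+\<omega>. ennreal c \<partial>M)" by (intro nn_integral_mono) (auto split: split_indicator)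
      finally show "(\<integral>\<^sup>+\<omega>. indicator {t<..} (\<tau> \<omega>) * indicator UNIV (?Z \<omega>) * (N (\<zeta> t \<omega>) / D (\<zeta> t \<omega>)) \<partial>M) \<noteq> \<infinity>"
        by (auto simp: emeasure_space_1 top_unique)
    qed measurable
    then show ?thesis by eventually_elim (auto simp: less_top)
  qed
  (* The first case is {\<tau> \<le> t}, read off from the value at t. *)
  define H where "H x = (if 0 < t \<and> x = z then g z else enn2real (N x / D x))" for x
  have H_meas [measurable]: "H \<in> borel_measurable borel" unfolding H_def by measurable
  have H_AE: "AE \<omega> in M. ennreal (H (\<zeta> t \<omega>)) = indicator {t<..} (\<tau> \<omega>) * (N (\<zeta> t \<omega>) / D (\<zeta> t \<omega>)) + indicator {..t} (\<tau> \<omega>) * ennreal (g z)"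
    using ratio_fin AE_length_le_iff[OF t(1)]
  proof eventually_elim
    case (elim \<omega>)
    show ?case
    proof (cases "\<tau> \<omega> \<le> t")
      case True
      then show ?thesis using elim(2) by (simp add: H_def)
    next
      case False
      then have "ennreal (enn2real (N (\<zeta> t \<omega>) / D (\<zeta> t \<omega>))) = N (\<zeta> t \<omega>) / D (\<zeta> t \<omega>)"
        using elim(1) by (intro ennreal_enn2real) auto
      then show ?thesis using elim(2) False by (auto simp: H_def)
    qed
  qed
  show ?thesis
  proof (intro bexI[OF _ H_meas] conjI allI ballI)
    show "0 \<le> H x" for x by (simp add: H_def g0)
    fix B assume B [measurable]: "B \<in> sets (hist {0..t})"
    have "(\<integral>\<^sup>+\<omega>. indicator B (?Z \<omega>) * ennreal (H (\<zeta> t \<omega>)) \<partial>M)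
      = (\<integral>\<^sup>+\<omega>. indicator {t<..} (\<tau> \<omega>) * indicator B (?Z \<omega>) * (N (\<zeta> t \<omega>) / D (\<zeta> t \<omega>))
          + indicator {..t} (\<tau> \<omega>) * indicator B (?Z \<omega>) * ennreal (g z) \<partial>M)"
      by (rule nn_integral_cong_AE) (use H_AE in \<open>eventually_elim, simp add: distrib_left mult_ac\<close>)
    also have "\<dots> = (\<integral>\<^sup>+\<omega>. indicator {t<..} (\<tau> \<omega>) * indicator B (?Z \<omega>) * (N (\<zeta> t \<omega>) / D (\<zeta> t \<omega>)) \<partial>M)
          + (\<integral>\<^sup>+\<omega>. indicator {..t} (\<tau> \<omega>) * indicator B (?Z \<omega>) * ennreal (g z) \<partial>M)"
      by (rule nn_integral_add) measurable
    also have "\<dots> = (\<integral>\<^sup>+\<omega>. indicator {t<..} (\<tau> \<omega>) * indicator B (?Z \<omega>) * ennreal (g (\<zeta> u \<omega>)) \<partial>M)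
          + (\<integral>\<^sup>+\<omega>. indicator {..t} (\<tau> \<omega>) * indicator B (?Z \<omega>) * ennreal (g z) \<partial>M)"
      by (simp only: ratio[OF B])
    also have "\<dots> = (\<integral>\<^sup>+\<omega>. indicator {t<..} (\<tau> \<omega>) * indicator B (?Z \<omega>) * ennreal (g (\<zeta> u \<omega>))
          + indicator {..t} (\<tau> \<omega>) * indicator B (?Z \<omega>) * ennreal (g z) \<partial>M)"
      by (rule nn_integral_add[symmetric]) measurable
    also have "\<dots> = (\<integral>\<^sup>+\<omega>. indicator B (?Z \<omega>) * ennreal (g (\<zeta> u \<omega>)) \<partial>M)"
    proof (rule nn_integral_cong_AE)
      show "AE \<omega> in M. indicator {t<..} (\<tau> \<omega>) * indicator B (?Z \<omega>) * ennreal (g (\<zeta> u \<omega>))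
          + indicator {..t} (\<tau> \<omega>) * indicator B (?Z \<omega>) * ennreal (g z) = indicator B (?Z \<omega>) * ennreal (g (\<zeta> u \<omega>))"
        using AE_after_length[OF u] by eventually_elim (use t in \<open>auto split: split_indicator\<close>)
    qed
    finally show "(\<integral>\<^sup>+\<omega>. indicator B (?Z \<omega>) * ennreal (H (\<zeta> t \<omega>)) \<partial>M) = (\<integral>\<^sup>+\<omega>. indicator B (?Z \<omega>) * ennreal (g (\<zeta> u \<omega>)) \<partial>M)" .
  qed
qed

text \<open>A bounded function becomes nonnegative after adding a constant, and an event of the completed past may
  be replaced by the set of paths that represents it.\<close>

lemma transition_function:
  fixes g :: "real \<Rightarrow> real"
  assumes t: "0 \<le> t" "t < u" and g [measurable]: "g \<in> borel_measurable borel" and "bounded (range g)"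
  shows "\<exists>H\<in>borel_measurable borel. integrable M (\<lambda>\<omega>. H (\<zeta> t \<omega>)) \<and>
    (\<forall>A\<in>sets (completed_filtration M \<zeta> t). (\<integral>\<omega>\<in>A. g (\<zeta> u \<omega>) \<partial>M) = (\<integral>\<omega>\<in>A. H (\<zeta> t \<omega>) \<partial>M))"
proof -
  let ?Z = "\<lambda>\<omega> q. \<zeta> q \<omega>"
  obtain c where c: "\<And>x. \<bar>g x\<bar> \<le> c" using assms(4) by (auto simp: bounded_iff)
  have [measurable]: "\<zeta> t \<in> borel_measurable M" "\<zeta> u \<in> borel_measurable M" using t by (auto intro: bridge_measurable)
  define g' where "g' x = g x + c" for x
  have g' [measurable]: "g' \<in> borel_measurable borel" unfolding g'_def by measurable
  have g'_bounds: "0 \<le> g' x" "g' x \<le> 2 * c" for x using c[of x] by (auto simp: g'_def abs_le_iff)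
  from nonneg_transition_function[OF t g' g'_bounds]
  obtain H where H [measurable]: "H \<in> borel_measurable borel" and H0: "\<And>x. 0 \<le> H x"
    and eq: "\<And>B. B \<in> sets (hist {0..t}) \<Longrightarrow> (\<integral>\<^sup>+\<omega>. indicator B (?Z \<omega>) * ennreal (H (\<zeta> t \<omega>)) \<partial>M) = (\<integral>\<^sup>+\<omega>. indicator B (?Z \<omega>) * ennreal (g' (\<zeta> u \<omega>)) \<partial>M)"
    by blast
  have int_g': "integrable M (\<lambda>\<omega>. g' (\<zeta> u \<omega>))"
    by (rule integrable_const_bound[where B="2 * c"]) (use g'_bounds in auto)
  have int_H: "integrable M (\<lambda>\<omega>. H (\<zeta> t \<omega>))"
  proof (rule integrableI_nonneg)
    have "UNIV \<in> sets (hist {0..t})" using sets.top[of "hist {0..t}"] by simp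
    from eq[OF this] have "(\<integral>\<^sup>+\<omega>. ennreal (H (\<zeta> t \<omega>)) \<partial>M) = (\<integral>\<^sup>+\<omega>. ennreal (g' (\<zeta> u \<omega>)) \<partial>M)" by simp
    also have "\<dots> = ennreal (\<integral>\<omega>. g' (\<zeta> u \<omega>) \<partial>M)"
      using g'_bounds by (intro nn_integral_eq_integral int_g') auto
    finally show "(\<integral>\<^sup>+\<omega>. ennreal (H (\<zeta> t \<omega>)) \<partial>M) < \<infinity>" by simp
  qed (use H0 in auto)
  have set_eq: "(\<integral>\<omega>\<in>A. g' (\<zeta> u \<omega>) \<partial>M) = (\<integral>\<omega>\<in>A. H (\<zeta> t \<omega>) \<partial>M)" if A: "A \<in> sets (completed_filtration M \<zeta> t)" for A
  proof -
    obtain B where B: "B \<in> sets (hist {0..t})" and AB: "AE \<omega> in M. \<omega> \<in> A \<longleftrightarrow> ?Z \<omega> \<in> B" and [measurable]: "A \<in> sets M"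
      using A unfolding bridge_filtration_iff by blast
    have conv: "(\<integral>\<omega>\<in>A. h \<omega> \<partial>M) = enn2real (\<integral>\<^sup>+\<omega>. indicator B (?Z \<omega>) * ennreal (h \<omega>) \<partial>M)"
      if [measurable]: "h \<in> borel_measurable M" and "\<And>\<omega>. 0 \<le> h \<omega>" for h
    proof -
      have "(\<integral>\<omega>\<in>A. h \<omega> \<partial>M) = enn2real (\<integral>\<^sup>+\<omega>. ennreal (indicator A \<omega> * h \<omega>) \<partial>M)"
        unfolding set_lebesgue_integral_def using that(2) by (subst integral_eq_nn_integral) auto
      also have "(\<integral>\<^sup>+\<omega>. ennreal (indicator A \<omega> * h \<omega>) \<partial>M) = (\<integral>\<^sup>+\<omega>. indicator B (?Z \<omega>) * ennreal (h \<omega>) \<partial>M)"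
        by (rule nn_integral_cong_AE) (use AB in \<open>eventually_elim, auto split: split_indicator\<close>)
      finally show ?thesis .
    qed
    show ?thesis using eq[OF B] by (subst (1 2) conv) (use H0 g'_bounds in auto)
  qed
  show ?thesis
  proof (intro bexI[of _ "\<lambda>x. H x - c"] conjI ballI)
    show "integrable M (\<lambda>\<omega>. H (\<zeta> t \<omega>) - c)" using int_H by simp
    fix A assume A: "A \<in> sets (completed_filtration M \<zeta> t)"
    then have [measurable]: "A \<in> sets M"
      unfolding bridge_filtration_iff by blast
    have set_int: "set_integrable M A h" if "integrable M h" for h :: "'a \<Rightarrow> real"
      unfolding set_integrable_def using integrable_mult_indicator[OF \<open>A \<in> sets M\<close> that] .
    have "(\<integral>\<omega>\<in>A. g (\<zeta> u \<omega>) \<partial>M) = (\<integral>\<omega>\<in>A. g' (\<zeta> u \<omega>) - c \<partial>M)" by (simp add: g'_def)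
    also have "\<dots> = (\<integral>\<omega>\<in>A. g' (\<zeta> u \<omega>) \<partial>M) - (\<integral>\<omega>\<in>A. c \<partial>M)"
      by (intro set_integral_diff set_int int_g') simp
    also have "\<dots> = (\<integral>\<omega>\<in>A. H (\<zeta> t \<omega>) - c \<partial>M)"
      unfolding set_eq[OF A] by (intro set_integral_diff(2)[symmetric] set_int int_H) simp
    finally show "(\<integral>\<omega>\<in>A. g (\<zeta> u \<omega>) \<partial>M) = (\<integral>\<omega>\<in>A. H (\<zeta> t \<omega>) - c \<partial>M)" .
  qed simp
qed

text \<open>\<open>H(\<zeta>\<^sub>t)\<close> is measurable with respect to \<open>\<zeta>\<^sub>t\<close> and has the right integrals over all events of the
  completed past, so it is a version of the conditional expectation for every \<open>\<sigma>\<close>-algebra in between.\<close>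

theorem bridge_markov:
  assumes F: "\<And>t. 0 \<le> t \<Longrightarrow> space (F t) = space M"
    "\<And>t. 0 \<le> t \<Longrightarrow> sets (F t) = sets (completed_filtration M \<zeta> t)"
  shows "markov_wrt M F \<zeta>"
  unfolding markov_wrt_def
proof (intro allI impI)
  fix t u :: real and g :: "real \<Rightarrow> real"
  assume t: "0 \<le> t" "t < u" and g [measurable]: "g \<in> borel_measurable borel" and bdd: "bounded (range g)"
  let ?V = "vimage_algebra (space M) (\<zeta> t) borel"
  have [measurable]: "\<zeta> t \<in> borel_measurable M" "\<zeta> u \<in> borel_measurable M" using t by (auto intro: bridge_measurable)
  obtain H where H: "H \<in> borel_measurable borel" and int_H: "integrable M (\<lambda>\<omega>. H (\<zeta> t \<omega>))"
    and eq: "\<And>A. A \<in> sets (completed_filtration M \<zeta> t) \<Longrightarrow> (\<integral>\<omega>\<in>A. g (\<zeta> u \<omega>) \<partial>M) = (\<integral>\<omega>\<in>A. H (\<zeta> t \<omega>) \<partial>M)"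
    using transition_function[OF t g bdd] by blast
  obtain c where c: "\<And>x. \<bar>g x\<bar> \<le> c" using bdd by (auto simp: bounded_iff)
  have int_g: "integrable M (\<lambda>\<omega>. g (\<zeta> u \<omega>))"
    by (rule integrable_const_bound[where B=c]) (use c in auto)
  have V_sub: "sets ?V \<subseteq> sets (completed_filtration M \<zeta> t)"
  proof
    fix A assume "A \<in> sets ?V"
    then obtain D where D: "D \<in> sets borel" "A = \<zeta> t -` D \<inter> space M" by (auto simp: sets_vimage_algebra2)
    have "A \<in> sets M" unfolding D(2) using D(1) by measurable
    moreover have "{w. w t \<in> D} \<in> sets (hist {0..t})" using D t by (intro coordinate_event_in_hist) auto
    moreover have "AE \<omega> in M. \<omega> \<in> A \<longleftrightarrow> (\<lambda>q. \<zeta> q \<omega>) \<in> {w. w t \<in> D}"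
      using AE_space by eventually_elim (simp add: D)
    ultimately show "A \<in> sets (completed_filtration M \<zeta> t)"
      unfolding bridge_filtration_iff by blast
  qed
  have "H \<circ> \<zeta> t \<in> borel_measurable ?V"
    by (rule measurable_comp[OF measurable_vimage_algebra1 H]) auto
  then have HV: "(\<lambda>\<omega>. H (\<zeta> t \<omega>)) \<in> borel_measurable ?V" by (simp add: comp_def)
  have charact: "AE \<omega> in M. real_cond_exp M G (\<lambda>\<omega>. g (\<zeta> u \<omega>)) \<omega> = H (\<zeta> t \<omega>)"
    if G: "space G = space M" "sets ?V \<subseteq> sets G" "sets G \<subseteq> sets (completed_filtration M \<zeta> t)" for G
  proof -
    have "sets G \<subseteq> sets M"
      using G(3) unfolding subset_iff bridge_filtration_iff by blast
    then interpret finite_measure_subalgebra M G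
      by unfold_locales (simp add: subalgebra_def G(1))
    have "(\<lambda>\<omega>. H (\<zeta> t \<omega>)) \<in> borel_measurable G"
      using HV G(1,2) by (auto simp: measurable_def)
    then show ?thesis
      using G(3) by (intro real_cond_exp_charact int_g int_H eq) auto
  qed
  have 1: "AE \<omega> in M. real_cond_exp M (F t) (\<lambda>\<omega>. g (\<zeta> u \<omega>)) \<omega> = H (\<zeta> t \<omega>)"
    using V_sub by (intro charact) (simp_all add: F t)
  have 2: "AE \<omega> in M. real_cond_exp M ?V (\<lambda>\<omega>. g (\<zeta> u \<omega>)) \<omega> = H (\<zeta> t \<omega>)"
    using V_sub by (intro charact) simp_all
  show "AE \<omega> in M. real_cond_exp M (F t) (\<lambda>\<omega>. g (\<zeta> u \<omega>)) \<omega> = real_cond_exp M ?V (\<lambda>\<omega>. g (\<zeta> u \<omega>)) \<omega>"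
    using 1 2 by eventually_elim simp
qed

end

theorem theorem3p14:
  fixes M :: "'a measure"
    and X \<zeta> :: "real \<Rightarrow> 'a \<Rightarrow> real"
    and \<psi> :: "real \<Rightarrow> real"
    and \<tau> :: "'a \<Rightarrow> real"
    and z :: real
  assumes "prob_space M" and "complete_measure M"
    and "levy_process M X" and "symmetric_process M X" and "char_exponent M X \<psi>"
    and "\<And>t. t > 0 \<Longrightarrow> integrable lborel (\<lambda>u. exp (t * \<psi> u))"
    and "\<tau> \<in> borel_measurable M" and "\<And>\<omega>. \<omega> \<in> space M \<Longrightarrow> \<tau> \<omega> > 0"
    and "z \<in> admissible_endpoints M \<psi> \<tau>"
    and "random_length_bridge M \<psi> \<tau> z \<zeta>"
    and "\<And>\<delta>. \<delta> > 0 \<Longrightarrow> \<exists>t'>0.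
           (SUP t\<in>{0<..<t'}. SUP x\<in>{x. \<bar>x\<bar> > \<delta>}. ennreal \<bar>levy_density \<psi> t x\<bar>) < \<infinity>"
  shows "markov_wrt M (right_limit_filtration (completed_filtration M \<zeta>)) \<zeta> \<and>
    usual_conditions M (completed_filtration M \<zeta>) \<and>
    (\<forall>t\<ge>0. sets (right_limit_filtration (completed_filtration M \<zeta>) t) =
       sets (completed_filtration M \<zeta> t))"
proof -
  obtain Y where "levy_with_density M Y \<psi>"
    using levy_process_has_regular_version[OF assms(3,5,6)] by blast
  then interpret Y: levy_with_density M Y \<psi> .
  obtain \<kappa> where \<kappa>: "cadlag_process M \<zeta>" "cond_distribution M skorohod_space (path \<zeta>) borel \<tau> \<kappa>"
    "AE r in distr M borel \<tau>. levy_bridge \<psi> r z (\<kappa> r) (\<lambda>t w. w t)"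
    using assms(10) unfolding random_length_bridge_def by blast
  interpret random_bridge M Y \<psi> \<tau> z \<zeta> \<kappa>
    by unfold_locales (use assms(7,8) \<kappa> in \<open>auto simp: cadlag_process_def\<close>)
  let ?F = "completed_filtration M \<zeta>"
  have right: "sets (right_limit_filtration ?F t) = sets (?F t)" if "0 \<le> t" for t
    using completed_filtration_right_continuous[OF that]
    by (simp add: sets_right_limit_filtration[where \<Omega>="space M"])
  moreover have "markov_wrt M (right_limit_filtration ?F) \<zeta>"
  proof (rule bridge_markov)
    show "space (right_limit_filtration ?F t) = space M" for t
      by (simp add: right_limit_filtration_def space_measure_of_conv)
  qed (rule right)
  moreover have "usual_conditions M ?F"
    unfolding usual_conditions_def
    using completed_filtration_right_continuous by (auto simp: sets_completed_filtration)
  ultimately show ?thesis by blast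
qed

end
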